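(* Let $N_{12}$ be the simply connected nilpotent Lie group whose Lie algebra $\mathfrak n_{12}$ has a basis $(e_i)_{i=1}^7$ with dual basis satisfying $de^1=de^2=de^3=0$, $de^4=\frac{\sqrt3}{6}e^{12}$, $de^5=-\frac14e^{23}+\frac{\sqrt3}{12}e^{13}$, $de^6=-\frac{\sqrt3}{12}e^{23}-\frac14e^{13}$, $de^7=-\frac{\sqrt3}{6}e^{34}+\frac{\sqrt3}{12}e^{25}+\frac14e^{26}+\frac{\sqrt3}{12}e^{16}-\frac14e^{15}$, and let $\varphi_{12}$ be the closed left-invariant $G_2$-structure $$\varphi_{12}=-e^{124}+e^{135}+e^{167}-e^{236}+e^{257}+e^{347}-e^{456}.$$ Then $\varphi_{12}$ is not gradient up to homothetic $G_2$-structures: if $\psi$ is a left-invariant $G_2$-structure on $N_{12}$ homothetic to $\varphi_{12}$, there are no non-constant smooth $f:N_{12}\to\mathbb R$ and $\lambda\in\mathbb R$ such that $(\psi,\nabla f,\lambda)$ is a gradient Laplacian soliton.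
   Context: A $G_2$-structure on a $7$-manifold is a $3$-form $\varphi$ such that at each point there is a basis $(e_i)$ of the tangent space with $\varphi=e^{127}+e^{347}+e^{567}+e^{135}-e^{146}-e^{236}-e^{245}$. It induces a metric $g_\varphi$ and orientation by $g_\varphi(X,Y)\,\mathrm{vol}_\varphi=\frac16\,\iota_X\varphi\wedge\iota_Y\varphi\wedge\varphi$, hence a Hodge star $*$. It is closed if $d\varphi=0$. The Hodge Laplacian on $3$-forms is $\Delta_\varphi=*d*d-d*d*$. $(\varphi,\nabla f,\lambda)$ is a gradient Laplacian soliton if $\lambda\in\mathbb R$, $f$ is smooth, $\nabla f$ is complete and $\Delta_\varphi\varphi=\lambda\varphi+\mathcal L_{\nabla f}\varphi$. For closed $\varphi$ this gives $\mathrm{Hess} f=-g_\varphi(Q_\varphi\cdot,\cdot)-\frac13\lambda g_\varphi$, where $Q_\varphi=\mathrm{Ric}_\varphi-\frac1{12}\mathrm{tr}(\tau_\varphi^2)I+\frac12\tau_\varphi^2$ and $\tau_\varphi=-*d*\varphi$ is identified with a skew endomorphism by $\tau_\varphi(X,Y)=g_\varphi(\tau_\varphi X,Y)$. $G_2$-structures $\psi_1,\psi_2$ on Lie algebras $\mathfrak g_1,\mathfrak g_2$ (identified with left-invariant ones on the simply connected groups) are equivalent if there is a Lie algebra isomorphism $h:\mathfrak g_1\to\mathfrak g_2$ with $h\cdot\psi_1:=\psi_1(h^{-1}\cdot,h^{-1}\cdot,h^{-1}\cdot)=\psi_2$, and homothetic if $\psi_1$ is equivalent to $c\psi_2$ for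 some $c\in\mathbb R\setminus\{0\}$. Convention: $de^k(X,Y)=-e^k([X,Y])$. The basis $(e_i)$ is orthonormal for $g_{\varphi_{12}}$. *)

theory Defs
  imports "HOL-Analysis.Analysis" "HOL-Algebra.Group"
begin

text \<open>The manifold is \<^typ>\<open>real^7\<close>, and every tangent space is identified with \<^typ>\<open>real^7\<close>.
  Indices are elements of the type \<^typ>\<open>7\<close>, written 1, ..., 7 (there, 7 = 0).\<close>

type_synonym vec7 = "real^7"

primrec Ck :: "nat \<Rightarrow> ('a::real_normed_vector \<Rightarrow> 'b::real_normed_vector) \<Rightarrow> bool" where
  "Ck 0 f \<longleftrightarrow> continuous_on UNIV f"
| "Ck (Suc k) f \<longleftrightarrow> (\<forall>x. f differentiable (at x)) \<and> (\<forall>v. Ck k (\<lambda>x. frechet_derivative f (at x) v))"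

text \<open>On a finite-dimensional domain this is the usual smoothness.\<close>

definition smooth :: "('a::real_normed_vector \<Rightarrow> 'b::real_normed_vector) \<Rightarrow> bool" where
  "smooth f \<longleftrightarrow> (\<forall>k. Ck k f)"


section \<open>Alternating forms on a tangent space\<close>

text \<open>A k-form takes the list of its k arguments and is 0 on lists of any other length, so that
  the operations below need no degree argument and equality of forms is equality of functions.\<close>

type_synonym form = "vec7 list \<Rightarrow> real"

definition alt_form :: "nat \<Rightarrow> form \<Rightarrow> bool" where
  "alt_form k \<alpha> \<longleftrightarrow>
     (\<forall>vs. length vs \<noteq> k \<longrightarrow> \<alpha> vs = 0) \<and>
     (\<forall>vs i. length vs = k \<longrightarrow> i < k \<longrightarrow> linear (\<lambda>x. \<alpha> (vs[i := x]))) \<and>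
     (\<forall>vs. length vs = k \<longrightarrow> \<not> distinct vs \<longrightarrow> \<alpha> vs = 0)"

definition interior_product :: "vec7 \<Rightarrow> form \<Rightarrow> form" where
  "interior_product v \<alpha> vs = \<alpha> (v # vs)"

text \<open>The set S lists the positions of the arguments passed to \<^term>\<open>\<alpha>\<close>; only sets S whose
  cardinality is the degree of \<^term>\<open>\<alpha>\<close> contribute, so this is the sum over shuffles.
  On 1-forms, the wedge of a and b maps [x, y] to a x * b y - a y * b x.\<close>

definition wedge :: "form \<Rightarrow> form \<Rightarrow> form" where
  "wedge \<alpha> \<beta> vs =
     (\<Sum>S\<in>Pow {..<length vs}.
        (-1) ^ card {(i, j). i \<in> S \<and> j \<in> {..<length vs} - S \<and> j < i} *
        \<alpha> (nths vs S) * \<beta> (nths vs (- S)))"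

definition is_basis :: "(7 \<Rightarrow> vec7) \<Rightarrow> bool" where
  "is_basis e \<longleftrightarrow> inj e \<and> independent (range e) \<and> span (range e) = UNIV"

definition dual_basis :: "(7 \<Rightarrow> vec7) \<Rightarrow> 7 \<Rightarrow> vec7 \<Rightarrow> real" where
  "dual_basis e k v = representation (range e) v (e k)"

text \<open>\<open>basis_form e [i, j, k]\<close> is the form written $e^{ijk}$.\<close>

primrec basis_form :: "(7 \<Rightarrow> vec7) \<Rightarrow> 7 list \<Rightarrow> form" where
  "basis_form e [] = (\<lambda>vs. if vs = [] then 1 else 0)"
| "basis_form e (i # is) = wedge (\<lambda>vs. if length vs = 1 then dual_basis e i (hd vs) else 0) (basis_form e is)"


section \<open>Metric, volume form and Hodge star of a G2-form\<close>

definition g2_model :: "(7 \<Rightarrow> vec7) \<Rightarrow> form" where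
  "g2_model e = (\<lambda>vs. basis_form e [1,2,7] vs + basis_form e [3,4,7] vs + basis_form e [5,6,7] vs
     + basis_form e [1,3,5] vs - basis_form e [1,4,6] vs - basis_form e [2,3,6] vs - basis_form e [2,4,5] vs)"

definition inner_prod :: "(vec7 \<Rightarrow> vec7 \<Rightarrow> real) \<Rightarrow> bool" where
  "inner_prod g \<longleftrightarrow> bilinear g \<and> (\<forall>x y. g x y = g y x) \<and> (\<forall>x. x \<noteq> 0 \<longrightarrow> g x x > 0)"

definition orthonormal_basis :: "(vec7 \<Rightarrow> vec7 \<Rightarrow> real) \<Rightarrow> (7 \<Rightarrow> vec7) \<Rightarrow> bool" where
  "orthonormal_basis g e \<longleftrightarrow> is_basis e \<and> (\<forall>i j. g (e i) (e j) = (if i = j then 1 else 0))"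

text \<open>The orientation is determined together with the metric: \<open>vol\<close> may be the Riemannian volume
  form of \<open>g\<close> for either orientation.\<close>

definition g2_induces :: "form \<Rightarrow> (vec7 \<Rightarrow> vec7 \<Rightarrow> real) \<Rightarrow> form \<Rightarrow> bool" where
  "g2_induces \<phi> g vol \<longleftrightarrow>
     inner_prod g \<and>
     (\<exists>e. orthonormal_basis g e \<and> vol = basis_form e [1,2,3,4,5,6,7]) \<and>
     (\<forall>X Y vs. g X Y * vol vs = 1/6 * wedge (wedge (interior_product X \<phi>) (interior_product Y \<phi>)) \<phi> vs)"

definition g2_metric :: "form \<Rightarrow> vec7 \<Rightarrow> vec7 \<Rightarrow> real" where
  "g2_metric \<phi> = (THE g. \<exists>vol. g2_induces \<phi> g vol)"

definition g2_vol :: "form \<Rightarrow> form" where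
  "g2_vol \<phi> = (THE vol. \<exists>g. g2_induces \<phi> g vol)"

text \<open>For an orthonormal basis with \<open>vol (e\<^sub>1, \<dots>, e\<^sub>7) = 1\<close> this sends $e^{1 \dots k}$ to $e^{k+1 \dots 7}$;
  the sum does not depend on the choice of the orthonormal basis. If \<open>\<alpha>\<close> has degree k, then only
  lists \<open>ws\<close> of length 7 - k contribute.\<close>

definition hodge :: "(vec7 \<Rightarrow> vec7 \<Rightarrow> real) \<Rightarrow> form \<Rightarrow> form \<Rightarrow> form" where
  "hodge g vol \<alpha> ws =
     (let e = (SOME e. orthonormal_basis g e); k = 7 - length ws
      in 1 / fact k * (\<Sum>is | length is = k. \<alpha> (map e is) * vol (map e is @ ws)))"


section \<open>Differential forms and vector fields\<close>

type_synonym form_field = "vec7 \<Rightarrow> form"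

definition diff_form :: "nat \<Rightarrow> form_field \<Rightarrow> bool" where
  "diff_form k \<omega> \<longleftrightarrow> (\<forall>x. alt_form k (\<omega> x)) \<and> (\<forall>vs. smooth (\<lambda>x. \<omega> x vs))"

text \<open>The general formula for the exterior derivative, evaluated on constant vector fields, whose
  brackets vanish.\<close>

definition ext_d :: "form_field \<Rightarrow> form_field" where
  "ext_d \<omega> x vs =
     (\<Sum>i<length vs. (-1) ^ i *
        frechet_derivative (\<lambda>y. \<omega> y (take i vs @ drop (Suc i) vs)) (at x) (vs ! i))"

definition lie_bracket :: "(vec7 \<Rightarrow> vec7) \<Rightarrow> (vec7 \<Rightarrow> vec7) \<Rightarrow> vec7 \<Rightarrow> vec7" where
  "lie_bracket X Y x = frechet_derivative Y (at x) (X x) - frechet_derivative X (at x) (Y x)"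

text \<open>The Leibniz rule for the Lie derivative of a covariant tensor, evaluated on constant vector
  fields.\<close>

definition lie_derivative :: "(vec7 \<Rightarrow> vec7) \<Rightarrow> form_field \<Rightarrow> form_field" where
  "lie_derivative X \<omega> x vs =
     frechet_derivative (\<lambda>y. \<omega> y vs) (at x) (X x)
     - (\<Sum>i<length vs. \<omega> x (vs[i := lie_bracket X (\<lambda>_. vs ! i) x]))"

definition complete_field :: "(vec7 \<Rightarrow> vec7) \<Rightarrow> bool" where
  "complete_field X \<longleftrightarrow>
     (\<forall>p. \<exists>\<gamma>. \<gamma> 0 = p \<and> (\<forall>t::real. (\<gamma> has_vector_derivative X (\<gamma> t)) (at t)))"


section \<open>G2-structures and gradient Laplacian solitons\<close>

definition g2_structure :: "form_field \<Rightarrow> bool" where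
  "g2_structure \<phi> \<longleftrightarrow> diff_form 3 \<phi> \<and> (\<forall>x. \<exists>e. is_basis e \<and> \<phi> x = g2_model e)"

definition g2_star :: "form_field \<Rightarrow> form_field \<Rightarrow> form_field" where
  "g2_star \<phi> \<omega> x = hodge (g2_metric (\<phi> x)) (g2_vol (\<phi> x)) (\<omega> x)"

definition hodge_laplacian :: "form_field \<Rightarrow> form_field \<Rightarrow> form_field" where
  "hodge_laplacian \<phi> \<omega> x vs =
     g2_star \<phi> (ext_d (g2_star \<phi> (ext_d \<omega>))) x vs
     - ext_d (g2_star \<phi> (ext_d (g2_star \<phi> \<omega>))) x vs"

definition gradient :: "form_field \<Rightarrow> (vec7 \<Rightarrow> real) \<Rightarrow> vec7 \<Rightarrow> vec7" where
  "gradient \<phi> f x = (THE X. \<forall>v. g2_metric (\<phi> x) X v = frechet_derivative f (at x) v)"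

definition gradient_laplacian_soliton :: "form_field \<Rightarrow> (vec7 \<Rightarrow> real) \<Rightarrow> real \<Rightarrow> bool" where
  "gradient_laplacian_soliton \<phi> f lam \<longleftrightarrow>
     g2_structure \<phi> \<and> smooth f \<and> complete_field (gradient \<phi> f) \<and>
     (\<forall>x vs. hodge_laplacian \<phi> \<phi> x vs = lam * \<phi> x vs + lie_derivative (gradient \<phi> f) \<phi> x vs)"


section \<open>Lie groups with underlying manifold real^7\<close>

definition lie_group :: "vec7 monoid \<Rightarrow> bool" where
  "lie_group G \<longleftrightarrow> group G \<and> carrier G = UNIV \<and>
     smooth (\<lambda>(x, y). x \<otimes>\<^bsub>G\<^esub> y) \<and> smooth (\<lambda>x. inv\<^bsub>G\<^esub> x)"

definition left_invariant :: "vec7 monoid \<Rightarrow> form_field \<Rightarrow> bool" where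
  "left_invariant G \<omega> \<longleftrightarrow>
     (\<forall>p x vs. \<omega> (p \<otimes>\<^bsub>G\<^esub> x) (map (frechet_derivative (\<lambda>y. p \<otimes>\<^bsub>G\<^esub> y) (at x)) vs) = \<omega> x vs)"

text \<open>The Lie algebra is the tangent space at the identity, with the bracket of the left-invariant
  vector fields. A left-invariant form is identified with its value at the identity.\<close>

definition left_field :: "vec7 monoid \<Rightarrow> vec7 \<Rightarrow> vec7 \<Rightarrow> vec7" where
  "left_field G v p = frechet_derivative (\<lambda>x. p \<otimes>\<^bsub>G\<^esub> x) (at \<one>\<^bsub>G\<^esub>) v"

definition lie_algebra_bracket :: "vec7 monoid \<Rightarrow> vec7 \<Rightarrow> vec7 \<Rightarrow> vec7" where
  "lie_algebra_bracket G v w = lie_bracket (left_field G v) (left_field G w) \<one>\<^bsub>G\<^esub>"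

definition lie_algebra_iso ::
  "(vec7 \<Rightarrow> vec7 \<Rightarrow> vec7) \<Rightarrow> (vec7 \<Rightarrow> vec7 \<Rightarrow> vec7) \<Rightarrow> (vec7 \<Rightarrow> vec7) \<Rightarrow> bool" where
  "lie_algebra_iso br1 br2 h \<longleftrightarrow> linear h \<and> bij h \<and> (\<forall>v w. h (br1 v w) = br2 (h v) (h w))"

definition equivalent ::
  "(vec7 \<Rightarrow> vec7 \<Rightarrow> vec7) \<Rightarrow> form \<Rightarrow> (vec7 \<Rightarrow> vec7 \<Rightarrow> vec7) \<Rightarrow> form \<Rightarrow> bool" where
  "equivalent br1 \<psi>1 br2 \<psi>2 \<longleftrightarrow>
     (\<exists>h. lie_algebra_iso br1 br2 h \<and> (\<lambda>vs. \<psi>1 (map (inv_into UNIV h) vs)) = \<psi>2)"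

definition homothetic ::
  "(vec7 \<Rightarrow> vec7 \<Rightarrow> vec7) \<Rightarrow> form \<Rightarrow> (vec7 \<Rightarrow> vec7 \<Rightarrow> vec7) \<Rightarrow> form \<Rightarrow> bool" where
  "homothetic br1 \<psi>1 br2 \<psi>2 \<longleftrightarrow> (\<exists>c. c \<noteq> 0 \<and> equivalent br1 \<psi>1 br2 (\<lambda>vs. c * \<psi>2 vs))"


section \<open>The Lie algebra n12 and the form phi12\<close>

text \<open>The structure equations, with $de^k(X, Y) = -e^k([X, Y])$.\<close>

definition n12_basis :: "(vec7 \<Rightarrow> vec7 \<Rightarrow> vec7) \<Rightarrow> (7 \<Rightarrow> vec7) \<Rightarrow> bool" where
  "n12_basis br e \<longleftrightarrow> is_basis e \<and>
     (\<forall>X Y. let de = (\<lambda>k. - dual_basis e k (br X Y)); w = (\<lambda>i j. basis_form e [i, j] [X, Y]) in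
        de 1 = 0 \<and> de 2 = 0 \<and> de 3 = 0 \<and>
        de 4 = sqrt 3 / 6 * w 1 2 \<and>
        de 5 = - (1/4) * w 2 3 + sqrt 3 / 12 * w 1 3 \<and>
        de 6 = - (sqrt 3 / 12) * w 2 3 - 1/4 * w 1 3 \<and>
        de 7 = - (sqrt 3 / 6) * w 3 4 + sqrt 3 / 12 * w 2 5 + 1/4 * w 2 6
               + sqrt 3 / 12 * w 1 6 - 1/4 * w 1 5)"

definition phi12 :: "(7 \<Rightarrow> vec7) \<Rightarrow> form" where
  "phi12 e = (\<lambda>vs. - basis_form e [1,2,4] vs + basis_form e [1,3,5] vs + basis_form e [1,6,7] vs
     - basis_form e [2,3,6] vs + basis_form e [2,5,7] vs + basis_form e [3,4,7] vs - basis_form e [4,5,6] vs)"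

end

theory Submission
  imports Defs "HOL-Library.Function_Algebras"
begin

text \<open>A structure \<open>\<psi>\<close> homothetic to \<open>\<phi>\<^sub>1\<^sub>2\<close> is \<open>\<phi>\<^sub>1\<^sub>2\<close> for another frame \<open>F\<^sub>1, \<dots>, F\<^sub>7\<close> of left-invariant
  fields, whose brackets are those of \<open>n\<^sub>1\<^sub>2\<close> multiplied by a constant \<open>s \<noteq> 0\<close> (\<open>homothetic_adapted_basis\<close>,
  \<open>n12_frame_left_fields\<close>). In this frame, with dual coframe \<open>F\<^sup>1, \<dots>, F\<^sup>7\<close>, the Laplacian of \<open>\<psi>\<close> is
  \<open>s\<^sup>2/4 (F\<^sup>1\<^sup>3\<^sup>5 - F\<^sup>2\<^sup>3\<^sup>6)\<close> (\<open>laplacian_phi12\<close>).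

  The soliton equation therefore prescribes constant coefficients for the Lie derivative of \<open>\<psi>\<close> along
  the gradient of \<open>f\<close>. With \<open>u\<^sub>i = F\<^sub>i f\<close>, these coefficients are linear in the derivatives \<open>F\<^sub>a u\<^sub>i\<close> and in
  the \<open>u\<^sub>j\<close>, and their symmetric part is the Hessian equation (\<open>coframe_variation_eq\<close>, \<open>lie_components\<close>).
  A few of its entries are already contradictory (\<open>no_soliton\<close>): each \<open>F\<^sub>i u\<^sub>i\<close> is constant, the central
  field \<open>F\<^sub>7\<close> acts on the pair \<open>(u\<^sub>3, u\<^sub>4)\<close> as an infinitesimal rotation, and since \<open>F\<^sub>7\<close> commutes with \<open>F\<^sub>3\<close>
  and \<open>F\<^sub>4\<close> this forces \<open>F\<^sub>3 u\<^sub>4 = F\<^sub>4 u\<^sub>3 = 0\<close>. As \<open>[F\<^sub>3, F\<^sub>4]\<close> is a nonzero multiple of \<open>F\<^sub>7\<close>, it follows that \<open>u\<^sub>7\<close> is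
  zero, and then \<open>u\<^sub>3\<close> and \<open>u\<^sub>4\<close> are zero as well. But the constants \<open>F\<^sub>3 u\<^sub>3\<close> and \<open>F\<^sub>7 u\<^sub>7\<close> differ by \<open>s\<^sup>2/4\<close>.

  The work lies in computing with forms on lists of vectors. The common principle is that every
  operation on a form is determined by its commutation rule with the interior product by a first
  argument \<open>v\<close>: the wedge product (\<open>wedge_rec\<close>), the exterior derivative (\<open>ext_d_rec\<close>) and the Lie
  derivative (\<open>lie_derivative_rec\<close>) satisfy recursions along the list of arguments, and induction on
  this list gives associativity, antisymmetry and the Leibniz rules. Every form below is a combination
  of products of coframe covectors, so that all differentials become rewriting. The metric of the
  frame is induced by \<open>\<phi>\<^sub>1\<^sub>2\<close> by \<open>g2_induces_phi12\<close>; it is the only one by \<open>g2_induces_unique\<close>, and its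
  Hodge star is computed by \<open>hodge_basis_form\<close>.\<close>


section \<open>Differentiable functions and second derivatives\<close>

lemma Ck_SucD: "Ck (Suc k) f \<Longrightarrow> Ck k f"
proof (induction k arbitrary: f)
  case 0
  then show ?case
    by (auto simp: continuous_on_eq_continuous_within intro!: differentiable_imp_continuous_within)
next
  case (Suc k)
  then show ?case by (metis Ck.simps(2))
qed

lemma Ck_has_derivative:
  "Ck (Suc k) f \<Longrightarrow> (f has_derivative frechet_derivative f (at x)) (at x)"
  by (metis Ck.simps(2) frechet_derivative_works)

lemma Ck_directional: "Ck (Suc k) f \<Longrightarrow> Ck k (\<lambda>x. frechet_derivative f (at x) v)"
  by simp

lemma Ck_affine:
  assumes "Ck k f" "bounded_linear A"
  shows "Ck k (\<lambda>x. f (A x + b))"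
  using assms(1)
proof (induction k arbitrary: f)
  case 0
  then have "continuous_on UNIV (\<lambda>x. A x + b)"
    using assms(2) by (intro continuous_intros linear_continuous_on)
  with 0 show ?case
    by (auto intro: continuous_on_compose2)
next
  case (Suc k)
  have d: "((\<lambda>x. f (A x + b)) has_derivative (\<lambda>v. frechet_derivative f (at (A x + b)) (A v))) (at x)" for x
  proof -
    have "((\<lambda>x. A x + b) has_derivative A) (at x)"
      using assms(2) by (auto intro!: derivative_eq_intros bounded_linear_imp_has_derivative)
    from diff_chain_at[OF this Ck_has_derivative[OF Suc.prems]] show ?thesis
      by (simp add: o_def)
  qed
  have "frechet_derivative (\<lambda>x. f (A x + b)) (at x) v = frechet_derivative f (at (A x + b)) (A v)" for x v
    using frechet_derivative_at[OF d] by metis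
  then show ?case
    using d Suc.IH[OF Ck_directional[OF Suc.prems]] by (auto simp: differentiable_def)
qed

lemma Ck_bounded_linear:
  assumes "Ck k f" "bounded_linear L"
  shows "Ck k (\<lambda>x. L (f x))"
  using assms(1)
proof (induction k arbitrary: f)
  case 0
  then show ?case
    using assms(2) by (auto intro: bounded_linear.continuous_on)
next
  case (Suc k)
  have d: "((\<lambda>x. L (f x)) has_derivative (\<lambda>v. L (frechet_derivative f (at x) v))) (at x)" for x
    using bounded_linear.has_derivative[OF assms(2) Ck_has_derivative[OF Suc.prems]] .
  have "frechet_derivative (\<lambda>x. L (f x)) (at x) v = L (frechet_derivative f (at x) v)" for x v
    using frechet_derivative_at[OF d] by metis
  then show ?case
    using d Suc.IH[OF Ck_directional[OF Suc.prems]] by (auto simp: differentiable_def)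
qed

lemma Ck_add:
  assumes "Ck k f" "Ck k g"
  shows "Ck k (\<lambda>x. f x + g x)"
  using assms
proof (induction k arbitrary: f g)
  case 0
  then show ?case by (auto intro: continuous_intros)
next
  case (Suc k)
  have d: "((\<lambda>x. f x + g x) has_derivative
      (\<lambda>v. frechet_derivative f (at x) v + frechet_derivative g (at x) v)) (at x)" for x
    using has_derivative_add[OF Ck_has_derivative[OF Suc.prems(1)] Ck_has_derivative[OF Suc.prems(2)]] .
  have "frechet_derivative (\<lambda>x. f x + g x) (at x) v
      = frechet_derivative f (at x) v + frechet_derivative g (at x) v" for x v
    using frechet_derivative_at[OF d] by metis
  then show ?case
    using d Suc.IH[OF Ck_directional[OF Suc.prems(1)] Ck_directional[OF Suc.prems(2)]]
    by (auto simp: differentiable_def)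
qed

lemma Ck_mult:
  fixes f g :: "'a::real_normed_vector \<Rightarrow> real"
  assumes "Ck k f" "Ck k g"
  shows "Ck k (\<lambda>x. f x * g x)"
  using assms
proof (induction k arbitrary: f g)
  case 0
  then show ?case by (auto intro: continuous_intros)
next
  case (Suc k)
  have d: "((\<lambda>x. f x * g x) has_derivative
      (\<lambda>v. f x * frechet_derivative g (at x) v + frechet_derivative f (at x) v * g x)) (at x)" for x
    using has_derivative_mult[OF Ck_has_derivative[OF Suc.prems(1)] Ck_has_derivative[OF Suc.prems(2)]] .
  have "frechet_derivative (\<lambda>x. f x * g x) (at x) v
      = f x * frechet_derivative g (at x) v + frechet_derivative f (at x) v * g x" for x v
    using frechet_derivative_at[OF d] by metis
  moreover have "Ck k f" "Ck k g"
    using Suc.prems Ck_SucD by blast+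
  ultimately show ?case
    using d Suc.IH[OF \<open>Ck k f\<close> Ck_directional[OF Suc.prems(2)]]
      Suc.IH[OF Ck_directional[OF Suc.prems(1)] \<open>Ck k g\<close>]
    by (auto simp: differentiable_def intro!: Ck_add)
qed

lemma Ck_const: "Ck k (\<lambda>x. c)"
proof (induction k arbitrary: c)
  case (Suc k)
  then show ?case by (simp add: frechet_derivative_const)
qed simp

lemma Ck_sum:
  assumes "\<And>i. i \<in> I \<Longrightarrow> Ck k (f i)"
  shows "Ck k (\<lambda>x. \<Sum>i\<in>I. f i x)"
  using assms
proof (induction I rule: infinite_finite_induct)
  case (insert i I)
  then show ?case by (simp add: Ck_add)
qed (simp_all add: Ck_const)

lemma has_real_derivative_along_line:
  fixes h :: "'a::real_normed_vector \<Rightarrow> real"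
  assumes "Ck (Suc k) h"
  shows "((\<lambda>t. h (a + t *\<^sub>R u)) has_real_derivative frechet_derivative h (at (a + t *\<^sub>R u)) u) (at t)"
proof -
  have "((\<lambda>t. a + t *\<^sub>R u) has_derivative (\<lambda>s. s *\<^sub>R u)) (at t)"
    by (auto intro!: derivative_eq_intros)
  from diff_chain_at[OF this Ck_has_derivative[OF assms]]
  have d: "((\<lambda>t. h (a + t *\<^sub>R u)) has_derivative (\<lambda>s. frechet_derivative h (at (a + t *\<^sub>R u)) (s *\<^sub>R u))) (at t)"
    by (simp add: o_def)
  have "linear (frechet_derivative h (at (a + t *\<^sub>R u)))"
    using Ck_has_derivative[OF assms] has_derivative_linear by blast
  then have "(\<lambda>s. frechet_derivative h (at (a + t *\<^sub>R u)) (s *\<^sub>R u))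
      = (*) (frechet_derivative h (at (a + t *\<^sub>R u)) u)"
    by (auto simp: linear_cmul)
  with d show ?thesis
    by (simp add: has_field_derivative_def)
qed

text \<open>The second difference of \<open>h\<close> over a small parallelogram is, by the mean value theorem applied
  along one side and then along the other, the mixed derivative at a point of the parallelogram.\<close>

lemma second_difference:
  fixes h :: "'a::real_normed_vector \<Rightarrow> real"
  assumes h: "Ck (Suc (Suc 0)) h" and "0 < t"
  shows "\<exists>p q. 0 < p \<and> p < t \<and> 0 < q \<and> q < t \<and>
    h (x + t *\<^sub>R u + t *\<^sub>R v) - h (x + t *\<^sub>R u) - (h (x + t *\<^sub>R v) - h x)
    = t * (t * frechet_derivative (\<lambda>y. frechet_derivative h (at y) u) (at (x + p *\<^sub>R u + q *\<^sub>R v)) v)"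
proof -
  define g where "g s = h ((x + t *\<^sub>R v) + s *\<^sub>R u) - h (x + s *\<^sub>R u)" for s
  let ?u = "\<lambda>y. frechet_derivative h (at y) u"
  have "(g has_real_derivative (?u ((x + t *\<^sub>R v) + s *\<^sub>R u) - ?u (x + s *\<^sub>R u))) (at s)" for s
    unfolding g_def by (intro derivative_intros has_real_derivative_along_line[OF h])
  from MVT2[OF \<open>0 < t\<close> this]
  obtain p where p: "0 < p" "p < t" "g t - g 0 = t * (?u ((x + t *\<^sub>R v) + p *\<^sub>R u) - ?u (x + p *\<^sub>R u))"
    by auto
  have "((\<lambda>r. ?u ((x + p *\<^sub>R u) + r *\<^sub>R v)) has_real_derivative
      frechet_derivative ?u (at ((x + p *\<^sub>R u) + r *\<^sub>R v)) v) (at r)" for r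
    by (rule has_real_derivative_along_line[OF Ck_directional[OF h]])
  from MVT2[OF \<open>0 < t\<close> this]
  obtain q where q: "0 < q" "q < t"
      "?u ((x + p *\<^sub>R u) + t *\<^sub>R v) - ?u (x + p *\<^sub>R u)
       = t * frechet_derivative ?u (at ((x + p *\<^sub>R u) + q *\<^sub>R v)) v"
    by auto
  show ?thesis
    using p q by (intro exI[of _ p] exI[of _ q]) (simp add: g_def algebra_simps)
qed

lemma second_derivative_symmetric_real:
  fixes h :: "'a::real_normed_vector \<Rightarrow> real"
  assumes h: "Ck (Suc (Suc 0)) h"
  shows "frechet_derivative (\<lambda>y. frechet_derivative h (at y) u) (at x) v
       = frechet_derivative (\<lambda>y. frechet_derivative h (at y) v) (at x) u"
proof -
  define H where "H u v y = frechet_derivative (\<lambda>y. frechet_derivative h (at y) u) (at y) v" for u v y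
  have lim: "((\<lambda>t. H u v (x + p t *\<^sub>R u + q t *\<^sub>R v)) \<longlongrightarrow> H u v x) (at_right 0)"
    if "\<And>t. 0 < t \<Longrightarrow> 0 < p t \<and> p t < t \<and> 0 < q t \<and> q t < t" for p q u v
  proof -
    have "continuous_on UNIV (H u v)"
      using h by (simp add: H_def[abs_def])
    then have "isCont (H u v) x"
      by (simp add: continuous_on_eq_continuous_at)
    moreover have "(p \<longlongrightarrow> 0) (at_right 0)" "(q \<longlongrightarrow> 0) (at_right 0)"
      by (rule tendsto_sandwich[of "\<lambda>_. 0" _ _ "\<lambda>t. t"];
          use that in \<open>auto simp: eventually_at_filter intro!: always_eventually less_imp_le\<close>)+
    then have "((\<lambda>t. x + p t *\<^sub>R u + q t *\<^sub>R v) \<longlongrightarrow> x + 0 *\<^sub>R u + 0 *\<^sub>R v) (at_right 0)"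
      by (intro tendsto_intros)
    ultimately show ?thesis
      using isCont_tendsto_compose[of x "H u v"] by simp
  qed
  obtain p q where pq: "\<And>t. 0 < t \<Longrightarrow> 0 < p t \<and> p t < t \<and> 0 < q t \<and> q t < t \<and>
      h (x + t *\<^sub>R u + t *\<^sub>R v) - h (x + t *\<^sub>R u) - (h (x + t *\<^sub>R v) - h x)
      = t * (t * H u v (x + p t *\<^sub>R u + q t *\<^sub>R v))"
    using second_difference[OF h, of _ x u v] unfolding H_def by metis
  obtain p' q' where pq': "\<And>t. 0 < t \<Longrightarrow> 0 < p' t \<and> p' t < t \<and> 0 < q' t \<and> q' t < t \<and>
      h (x + t *\<^sub>R v + t *\<^sub>R u) - h (x + t *\<^sub>R v) - (h (x + t *\<^sub>R u) - h x)
      = t * (t * H v u (x + p' t *\<^sub>R v + q' t *\<^sub>R u))"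
    using second_difference[OF h, of _ x v u] unfolding H_def by metis
  have "H u v (x + p t *\<^sub>R u + q t *\<^sub>R v) = H v u (x + p' t *\<^sub>R v + q' t *\<^sub>R u)" if "0 < t" for t
  proof -
    have "t * (t * H u v (x + p t *\<^sub>R u + q t *\<^sub>R v)) = t * (t * H v u (x + p' t *\<^sub>R v + q' t *\<^sub>R u))"
      using pq[OF that] pq'[OF that] by (simp add: algebra_simps)
    with that show ?thesis by simp
  qed
  then have "\<forall>\<^sub>F t in at_right 0. H v u (x + p' t *\<^sub>R v + q' t *\<^sub>R u) = H u v (x + p t *\<^sub>R u + q t *\<^sub>R v)"
    by (simp add: eventually_at_filter)
  then have "((\<lambda>t. H u v (x + p t *\<^sub>R u + q t *\<^sub>R v)) \<longlongrightarrow> H v u x) (at_right 0)"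
    using lim[of p' q' v u] pq' by (auto intro: Lim_transform_eventually)
  then have "H u v x = H v u x"
    using lim[of p q u v] pq by (auto intro: tendsto_unique[rotated])
  then show ?thesis by (simp add: H_def)
qed

lemma second_derivative_symmetric:
  fixes h :: "'a::real_normed_vector \<Rightarrow> 'b::real_inner"
  assumes h: "Ck (Suc (Suc 0)) h"
  shows "frechet_derivative (\<lambda>y. frechet_derivative h (at y) u) (at x) v
       = frechet_derivative (\<lambda>y. frechet_derivative h (at y) v) (at x) u" (is "?l = ?r")
proof -
  have 1: "frechet_derivative (\<lambda>x. f x \<bullet> c) (at y) = (\<lambda>w. frechet_derivative f (at y) w \<bullet> c)"
    if "Ck (Suc k) f" for f :: "'a \<Rightarrow> 'b" and c y k
    using has_derivative_inner_left[OF Ck_has_derivative[OF that]] frechet_derivative_at by metis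
  have "?l \<bullet> c = ?r \<bullet> c" for c
  proof -
    have "Ck (Suc (Suc 0)) (\<lambda>y. h y \<bullet> c)"
      by (rule Ck_bounded_linear[OF h bounded_linear_inner_left])
    from second_derivative_symmetric_real[OF this, of u x v] show ?thesis
      unfolding 1[OF h] 1[OF Ck_directional[OF h]] .
  qed
  then show ?thesis
    using vector_eq_rdot by blast
qed

text \<open>Only differentiability of \<open>A\<close> at each fixed vector is asked for, since finitely many basis vectors
  determine a linear map. The two uses are the differential of a function evaluated on a vector field,
  and a moving coframe evaluated on a moving frame.\<close>

lemma has_derivative_linear_family:
  fixes A :: "'a::euclidean_space \<Rightarrow> 'c::euclidean_space \<Rightarrow> 'b::real_normed_vector"
  assumes lin: "\<And>y. linear (A y)" and A: "\<And>v. (\<lambda>y. A y v) differentiable (at x)"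
    and V: "(V has_derivative V') (at x)"
  shows "((\<lambda>y. A y (V y)) has_derivative
    (\<lambda>u. frechet_derivative (\<lambda>y. A y (V x)) (at x) u + A x (V' u))) (at x)"
proof -
  have exp: "A y w = (\<Sum>b\<in>Basis. (w \<bullet> b) *\<^sub>R A y b)" for y w
  proof -
    have "A y w = A y (\<Sum>b\<in>Basis. (w \<bullet> b) *\<^sub>R b)"
      by (simp add: euclidean_representation)
    then show ?thesis
      by (simp add: linear_sum[OF lin] linear_cmul[OF lin])
  qed
  have db: "((\<lambda>y. A y b) has_derivative frechet_derivative (\<lambda>y. A y b) (at x)) (at x)" for b
    using A frechet_derivative_works by blast
  have e0: "(\<lambda>y. A y (V x)) = (\<lambda>y. \<Sum>b\<in>Basis. (V x \<bullet> b) *\<^sub>R A y b)"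
    by (rule ext) (rule exp)
  have d0: "((\<lambda>y. A y (V x)) has_derivative
      (\<lambda>u. \<Sum>b\<in>Basis. (V x \<bullet> b) *\<^sub>R frechet_derivative (\<lambda>y. A y b) (at x) u)) (at x)"
    unfolding e0 by (intro has_derivative_sum has_derivative_scaleR_right db)
  have 1: "frechet_derivative (\<lambda>y. A y (V x)) (at x) u
      = (\<Sum>b\<in>Basis. (V x \<bullet> b) *\<^sub>R frechet_derivative (\<lambda>y. A y b) (at x) u)" for u
    using fun_cong[OF frechet_derivative_at[OF d0], of u] by simp
  have e1: "(\<lambda>y. A y (V y)) = (\<lambda>y. \<Sum>b\<in>Basis. (V y \<bullet> b) *\<^sub>R A y b)"
    by (rule ext) (rule exp)
  have e2: "(\<lambda>u. frechet_derivative (\<lambda>y. A y (V x)) (at x) u + A x (V' u))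
      = (\<lambda>u. \<Sum>b\<in>Basis. (V x \<bullet> b) *\<^sub>R frechet_derivative (\<lambda>y. A y b) (at x) u + (V' u \<bullet> b) *\<^sub>R A x b)"
    by (rule ext) (simp only: 1 exp[of x "V' _"] sum.distrib)
  show ?thesis
    unfolding e1 e2
    by (intro has_derivative_sum has_derivative_scaleR has_derivative_inner_left V db)
qed

lemma has_derivative_directional:
  fixes h :: "'a::euclidean_space \<Rightarrow> 'b::real_normed_vector"
  assumes h: "Ck (Suc (Suc 0)) h" and V: "(V has_derivative V') (at x)"
  shows "((\<lambda>y. frechet_derivative h (at y) (V y)) has_derivative
    (\<lambda>u. frechet_derivative (\<lambda>y. frechet_derivative h (at y) (V x)) (at x) u
       + frechet_derivative h (at x) (V' u))) (at x)"
proof (rule has_derivative_linear_family[OF _ _ V])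
  show "linear (frechet_derivative h (at y))" for y
    using Ck_has_derivative[OF h] has_derivative_linear by blast
  show "(\<lambda>y. frechet_derivative h (at y) v) differentiable (at x)" for v
    using h by simp
qed

text \<open>Both iterated derivatives contain the second derivative of \<open>h\<close>, which cancels by symmetry. For real
  functions this says that the bracket acts as a commutator; for a translation of a Lie group it says
  that the translation preserves brackets of fields that it preserves.\<close>

lemma commutator_of_fields:
  fixes h :: "'a::euclidean_space \<Rightarrow> 'b::real_inner"
  assumes h: "Ck (Suc (Suc 0)) h"
    and V: "(V has_derivative V') (at x)" and W: "(W has_derivative W') (at x)"
  shows "frechet_derivative (\<lambda>y. frechet_derivative h (at y) (W y)) (at x) (V x)
       - frechet_derivative (\<lambda>y. frechet_derivative h (at y) (V y)) (at x) (W x)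
       = frechet_derivative h (at x) (W' (V x) - V' (W x))"
proof -
  have "linear (frechet_derivative h (at x))"
    using Ck_has_derivative[OF h] has_derivative_linear by blast
  moreover note second_derivative_symmetric[OF h, of "V x" x "W x"]
  ultimately show ?thesis
    unfolding frechet_derivative_at[OF has_derivative_directional[OF h V], symmetric]
      frechet_derivative_at[OF has_derivative_directional[OF h W], symmetric]
    by (simp add: linear_diff)
qed


section \<open>Bases and coordinates\<close>

lemma exhaust_7: "(i::7) = 1 \<or> i = 2 \<or> i = 3 \<or> i = 4 \<or> i = 5 \<or> i = 6 \<or> i = 7"
proof (induct i)
  case (of_int z)
  then have "z = 0 \<or> z = 1 \<or> z = 2 \<or> z = 3 \<or> z = 4 \<or> z = 5 \<or> z = 6" by fastforce
  then show ?case by auto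
qed

lemma UNIV_7: "UNIV = {1, 2, 3, 4, 5, 6, 7::7}"
  using exhaust_7 by auto

lemma sum_7: "sum f (UNIV::7 set) = f 1 + f 2 + f 3 + f 4 + f 5 + f 6 + f 7"
  unfolding UNIV_7 by (simp add: ac_simps)

lemma forall_7: "(\<forall>i::7. P i) \<longleftrightarrow> P 1 \<and> P 2 \<and> P 3 \<and> P 4 \<and> P 5 \<and> P 6 \<and> P 7"
  by (metis exhaust_7)

lemma linear_dual_basis: "is_basis e \<Longrightarrow> linear (dual_basis e k)"
  by (rule linearI) (simp_all add: is_basis_def dual_basis_def representation_add representation_scale)

lemma dual_basis_self: "is_basis e \<Longrightarrow> dual_basis e i (e j) = (if i = j then 1 else 0)"
  by (auto simp: is_basis_def dual_basis_def representation_basis inj_eq)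

lemma basis_expansion:
  assumes "is_basis e"
  shows "v = (\<Sum>i\<in>UNIV. dual_basis e i v *\<^sub>R e i)"
proof -
  have "v = (\<Sum>b\<in>range e. representation (range e) v b *\<^sub>R b)"
    using assms by (intro sum_representation_eq[symmetric]) (auto simp: is_basis_def)
  also have "\<dots> = (\<Sum>i\<in>UNIV. dual_basis e i v *\<^sub>R e i)"
    using assms by (simp add: is_basis_def dual_basis_def sum.reindex)
  finally show ?thesis .
qed

lemma linear_expansion:
  assumes "is_basis e" "linear a"
  shows "a v = (\<Sum>i\<in>UNIV. dual_basis e i v *\<^sub>R a (e i))"
  by (subst basis_expansion[OF assms(1), of v])
     (simp add: linear_sum[OF assms(2)] linear_cmul[OF assms(2)])

text \<open>Biorthogonality detects bases: the functionals read off the coefficients of a linear relation, so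
  the vectors are independent, and there are as many of them as dimensions. All changes of basis below
  are made by exhibiting the dual functionals.\<close>

lemma biorthogonal_imp_dual_basis:
  fixes a :: "7 \<Rightarrow> vec7 \<Rightarrow> real"
  assumes lin: "\<And>i. linear (a i)" and ae: "\<And>i j. a i (e j) = (if i = j then 1 else 0)"
  shows "is_basis e" and "dual_basis e = a"
proof -
  have inj: "inj e"
    by (rule injI) (metis ae zero_neq_one)
  have "independent (range e)"
    unfolding independent_explicit_module
  proof (intro allI impI)
    fix t u v
    assume t: "finite t" "t \<subseteq> range e" "(\<Sum>v\<in>t. u v *\<^sub>R v) = 0" "v \<in> t"
    then obtain i where i: "v = e i" by auto
    have "0 = a i (\<Sum>v\<in>t. u v *\<^sub>R v)"
      by (simp add: t(3) linear_0[OF lin])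
    also have "\<dots> = (\<Sum>w\<in>t. if w = v then u v else 0)"
      using t(2) inj by (auto simp: linear_sum[OF lin] linear_cmul[OF lin] i ae inj_eq intro!: sum.cong)
    also have "\<dots> = u v"
      using t by simp
    finally show "u v = 0" by simp
  qed
  moreover have "UNIV \<subseteq> span (range e)"
    using calculation inj by (intro card_ge_dim_independent) (auto simp: card_image)
  ultimately show b: "is_basis e"
    using inj by (auto simp: is_basis_def)
  show "dual_basis e = a"
    using linear_expansion[OF b lin] by (auto simp: fun_eq_iff ae if_distrib[of "\<lambda>x. _ * x"] cong: if_cong)
qed


section \<open>The exterior algebra of lists of vectors\<close>

definition covector :: "(vec7 \<Rightarrow> real) \<Rightarrow> form" where
  "covector a = (\<lambda>vs. if length vs = 1 then a (hd vs) else 0)"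

abbreviation unit_form :: form where
  "unit_form \<equiv> (\<lambda>vs. if vs = [] then 1 else 0)"

definition cwedge :: "(vec7 \<Rightarrow> real) \<Rightarrow> form \<Rightarrow> form" where
  "cwedge a \<beta> = wedge (covector a) \<beta>"

definition scale_form :: "real \<Rightarrow> form \<Rightarrow> form" where
  "scale_form c \<alpha> = (\<lambda>vs. c * \<alpha> vs)"

definition homogeneous :: "nat \<Rightarrow> form \<Rightarrow> bool" where
  "homogeneous k \<alpha> \<longleftrightarrow> (\<forall>vs. length vs \<noteq> k \<longrightarrow> \<alpha> vs = 0)"

lemma scale_form_apply: "scale_form c \<alpha> vs = c * \<alpha> vs"
  by (simp add: scale_form_def)

lemma basis_form_Cons: "basis_form e (i # is) = cwedge (dual_basis e i) (basis_form e is)"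
  by (simp add: cwedge_def covector_def)

declare basis_form.simps(2) [simp del]

lemma interior_apply: "interior_product v \<alpha> vs = \<alpha> (v # vs)"
  by (simp add: interior_product_def)

lemma interior_linear:
  "interior_product v (\<alpha> + \<beta>) = interior_product v \<alpha> + interior_product v \<beta>"
  "interior_product v (\<alpha> - \<beta>) = interior_product v \<alpha> - interior_product v \<beta>"
  "interior_product v (- \<alpha>) = - interior_product v \<alpha>"
  "interior_product v 0 = 0"
  "interior_product v (scale_form c \<alpha>) = scale_form c (interior_product v \<alpha>)"
  by (auto simp: interior_product_def scale_form_def)

lemma interior_unit: "interior_product v unit_form = 0"
  by (auto simp: interior_product_def)

lemma homogeneous_interior: "homogeneous (Suc k) \<alpha> \<Longrightarrow> homogeneous k (interior_product v \<alpha>)"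
  by (auto simp: homogeneous_def interior_product_def)

lemma wedge_Nil: "wedge \<alpha> \<beta> [] = \<alpha> [] * \<beta> []"
  by (simp add: wedge_def)

text \<open>The interior product with a vector is an antiderivation: the shuffles of a list \<open>v # vs\<close> are
  those that pass \<open>v\<close> to the first factor and those that pass it to the second, and in the second case
  \<open>v\<close> is overtaken by all \<open>k\<close> arguments of \<open>\<alpha>\<close>. This recursion replaces the sum over shuffles from here
  on; the algebraic identities follow from it by induction on the list of arguments.\<close>

lemma wedge_rec:
  assumes "homogeneous k \<alpha>"
  shows "wedge \<alpha> \<beta> (v # vs)
    = wedge (interior_product v \<alpha>) \<beta> vs + (-1) ^ k * wedge \<alpha> (interior_product v \<beta>) vs"
proof -
  define n where "n = length vs"
  define inversions where "inversions m S = {(i, j). i \<in> S \<and> j \<in> {..<m} - S \<and> j < (i::nat)}" for m S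
  define t where "t S = (-1) ^ card (inversions (Suc n) S) * \<alpha> (nths (v # vs) S) * \<beta> (nths (v # vs) (- S))" for S
  have fin: "finite S" if "S \<subseteq> {..<n}" for S
    using that finite_subset by blast
  have fin_inv: "finite (inversions n S)" if "S \<subseteq> {..<n}" for S
    by (rule finite_subset[of _ "S \<times> {..<n}"]) (use that fin in \<open>auto simp: inversions_def\<close>)
  have Pow: "Pow {..<Suc n} = (\<lambda>S. insert 0 (Suc ` S)) ` Pow {..<n} \<union> (`) Suc ` Pow {..<n}"
  proof -
    have "{..<Suc n} = insert 0 (Suc ` {..<n})"
      by (simp add: lessThan_Suc_eq_insert_0)
    then show ?thesis
      by (simp add: Pow_insert image_Pow_surj[symmetric] image_image Un_commute)
  qed
  have inj0: "inj_on (\<lambda>S. insert 0 (Suc ` S)) (Pow {..<n})"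
    by (rule inj_onI) (auto simp: set_eq_iff image_iff)
  have inj1: "inj_on ((`) Suc) (Pow {..<n})"
    by (rule inj_onI) (auto simp: set_eq_iff image_iff)
  have disj: "(\<lambda>S. insert 0 (Suc ` S)) ` Pow {..<n} \<inter> (`) Suc ` Pow {..<n} = {}"
    by auto
  have t0: "t (insert 0 (Suc ` S)) = (-1) ^ card (inversions n S) * interior_product v \<alpha> (nths vs S) * \<beta> (nths vs (- S))"
    if "S \<subseteq> {..<n}" for S
  proof -
    have "inversions (Suc n) (insert 0 (Suc ` S)) = map_prod Suc Suc ` inversions n S"
      by (auto simp: inversions_def image_iff less_Suc_eq_0_disj map_prod_def split: prod.splits)
    then have "card (inversions (Suc n) (insert 0 (Suc ` S))) = card (inversions n S)"
      by (simp add: card_image inj_on_def map_prod_def split: prod.splits)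
    moreover have "{j. Suc j \<in> insert 0 (Suc ` S)} = S" "{j. Suc j \<in> - insert 0 (Suc ` S)} = - S"
      by auto
    ultimately show ?thesis
      by (simp add: t_def nths_Cons interior_product_def)
  qed
  have t1: "t (Suc ` S) = (-1) ^ k * ((-1) ^ card (inversions n S) * \<alpha> (nths vs S) * interior_product v \<beta> (nths vs (- S)))"
    if S: "S \<subseteq> {..<n}" for S
  proof -
    \<comment> \<open>The new position 0 is in the second factor and forms an inversion with every element of \<open>S\<close>.\<close>
    have e: "inversions (Suc n) (Suc ` S) = map_prod Suc Suc ` inversions n S \<union> (\<lambda>i. (Suc i, 0)) ` S"
      by (auto simp: inversions_def image_iff less_Suc_eq_0_disj map_prod_def split: prod.splits)
    have "card (inversions (Suc n) (Suc ` S)) = card (map_prod Suc Suc ` inversions n S) + card ((\<lambda>i. (Suc i, 0::nat)) ` S)"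
      unfolding e using S by (intro card_Un_disjoint) (auto simp: fin fin_inv)
    also have "\<dots> = card (inversions n S) + card S"
      by (simp add: card_image inj_on_def map_prod_def split: prod.splits)
    finally have c: "card (inversions (Suc n) (Suc ` S)) = card (inversions n S) + card S" .
    have "{i. i < length vs \<and> i \<in> S} = S"
      using S by (auto simp: n_def)
    then have l: "length (nths vs S) = card S"
      by (simp add: length_nths)
    have s: "{j. Suc j \<in> Suc ` S} = S" "{j. Suc j \<notin> Suc ` S} = - S"
      by auto
    show ?thesis
    proof (cases "card S = k")
      case True
      then show ?thesis
        by (simp add: t_def nths_Cons interior_product_def c s power_add)
    next
      case False
      then have "\<alpha> (nths vs S) = 0"
        using assms l by (simp add: homogeneous_def)
      then show ?thesis
        by (simp add: t_def nths_Cons s)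
    qed
  qed
  have "wedge \<alpha> \<beta> (v # vs) = sum t (Pow {..<Suc n})"
    by (simp add: wedge_def t_def inversions_def n_def)
  also have "\<dots> = (\<Sum>S\<in>Pow {..<n}. t (insert 0 (Suc ` S))) + (\<Sum>S\<in>Pow {..<n}. t (Suc ` S))"
    unfolding Pow by (subst sum.union_disjoint[OF _ _ disj]) (simp_all add: sum.reindex inj0 inj1)
  also have "\<dots> = wedge (interior_product v \<alpha>) \<beta> vs + (-1) ^ k * wedge \<alpha> (interior_product v \<beta>) vs"
    by (simp add: t0 t1 wedge_def sum_distrib_left inversions_def n_def)
  finally show ?thesis .
qed

lemma wedge_add_left: "wedge (\<alpha> + \<beta>) \<gamma> = wedge \<alpha> \<gamma> + wedge \<beta> \<gamma>"
  by (rule ext) (simp add: wedge_def algebra_simps sum.distrib)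

lemma wedge_add_right: "wedge \<alpha> (\<beta> + \<gamma>) = wedge \<alpha> \<beta> + wedge \<alpha> \<gamma>"
  by (rule ext) (simp add: wedge_def algebra_simps sum.distrib)

lemma wedge_scale_left: "wedge (scale_form c \<alpha>) \<beta> = scale_form c (wedge \<alpha> \<beta>)"
  by (rule ext) (simp add: wedge_def scale_form_def sum_distrib_left mult_ac)

lemma wedge_scale_right: "wedge \<alpha> (scale_form c \<beta>) = scale_form c (wedge \<alpha> \<beta>)"
  by (rule ext) (simp add: wedge_def scale_form_def sum_distrib_left mult_ac)

lemma minus_form_eq: "- \<alpha> = scale_form (- 1) \<alpha>"
  by (auto simp: scale_form_def)

lemma diff_form_eq: "\<alpha> - \<beta> = \<alpha> + scale_form (- 1) (\<beta> :: form)"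
  by (auto simp: scale_form_def)

lemma wedge_minus: "wedge (- \<alpha>) \<beta> = - wedge \<alpha> \<beta>" "wedge \<alpha> (- \<beta>) = - wedge \<alpha> \<beta>"
  by (simp_all add: minus_form_eq wedge_scale_left wedge_scale_right)

lemma wedge_diff: "wedge (\<alpha> - \<gamma>) \<beta> = wedge \<alpha> \<beta> - wedge \<gamma> \<beta>" "wedge \<alpha> (\<beta> - \<gamma>) = wedge \<alpha> \<beta> - wedge \<alpha> \<gamma>"
  by (simp_all add: diff_form_eq wedge_add_left wedge_add_right wedge_scale_left wedge_scale_right)

lemma wedge_zero: "wedge 0 \<beta> = 0" "wedge \<alpha> 0 = 0"
  by (rule ext, simp add: wedge_def)+

lemmas wedge_linear = wedge_add_left wedge_add_right wedge_minus wedge_diff wedge_zero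
  wedge_scale_left wedge_scale_right

lemma cwedge_linear:
  "cwedge a (\<alpha> + \<beta>) = cwedge a \<alpha> + cwedge a \<beta>"
  "cwedge a (\<alpha> - \<beta>) = cwedge a \<alpha> - cwedge a \<beta>"
  "cwedge a (- \<alpha>) = - cwedge a \<alpha>"
  "cwedge a 0 = 0"
  "cwedge a (scale_form c \<alpha>) = scale_form c (cwedge a \<alpha>)"
  by (simp_all add: cwedge_def wedge_linear)

lemma wedge_unit: "wedge unit_form \<beta> vs = \<beta> vs"
proof (induction vs arbitrary: \<beta>)
  case (Cons v vs)
  have "homogeneous 0 unit_form" by (simp add: homogeneous_def)
  from wedge_rec[OF this] Cons show ?case
    by (simp add: interior_unit wedge_zero interior_apply)
qed (simp add: wedge_Nil)

lemma homogeneous_covector: "homogeneous (Suc 0) (covector a)"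
  by (simp add: homogeneous_def covector_def)

lemma interior_covector: "interior_product v (covector a) = scale_form (a v) unit_form"
  by (auto simp: interior_product_def covector_def scale_form_def)

lemma cwedge_Nil: "cwedge a \<beta> [] = 0"
  by (simp add: cwedge_def wedge_Nil covector_def)

lemma cwedge_rec: "cwedge a \<beta> (v # vs) = a v * \<beta> vs - cwedge a (interior_product v \<beta>) vs"
  unfolding cwedge_def wedge_rec[OF homogeneous_covector]
  by (simp add: interior_covector wedge_scale_left scale_form_apply wedge_unit)

lemma interior_cwedge:
  "interior_product v (cwedge a \<beta>) = scale_form (a v) \<beta> - cwedge a (interior_product v \<beta>)"
  by (rule ext) (simp add: interior_apply cwedge_rec scale_form_apply)

lemma cwedge_swap: "cwedge a (cwedge b \<beta>) = - cwedge b (cwedge a \<beta>)"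
proof -
  have "cwedge a (cwedge b \<beta>) vs = - cwedge b (cwedge a \<beta>) vs" for vs
  proof (induction vs arbitrary: \<beta>)
    case (Cons v vs)
    then show ?case
      by (simp add: cwedge_rec interior_cwedge cwedge_linear scale_form_apply)
  qed (simp add: cwedge_Nil)
  then show ?thesis by auto
qed

lemma cwedge_same: "cwedge a (cwedge a \<beta>) = 0"
proof -
  have "cwedge a (cwedge a \<beta>) vs = 0" for vs
    using fun_cong[OF cwedge_swap[of a a \<beta>], of vs] by simp
  then show ?thesis by auto
qed

lemma homogeneous_cwedge:
  assumes "homogeneous k \<beta>" shows "homogeneous (Suc k) (cwedge a \<beta>)"
proof -
  have "cwedge a \<beta> vs = 0" if "homogeneous k \<beta>" "length vs \<noteq> Suc k" for vs k \<beta>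
    using that
  proof (induction vs arbitrary: k \<beta>)
    case (Cons v vs)
    show ?case
    proof (cases k)
      case 0
      then have "interior_product v \<beta> = 0"
        using Cons.prems by (auto simp: homogeneous_def interior_product_def)
      then show ?thesis
        using Cons.prems 0 by (simp add: cwedge_rec cwedge_linear homogeneous_def)
    next
      case (Suc l)
      then show ?thesis
        using Cons.prems Cons.IH[OF homogeneous_interior[of l \<beta> v]]
        by (simp add: cwedge_rec homogeneous_def)
    qed
  qed (simp add: cwedge_Nil)
  with assms show ?thesis by (auto simp: homogeneous_def)
qed

text \<open>Associativity with a covector as first factor suffices, because basis forms are built by wedging
  covectors one at a time.\<close>

lemma wedge_cwedge_aux:
  "homogeneous k \<beta> \<Longrightarrow> wedge (cwedge a \<beta>) \<gamma> vs = cwedge a (wedge \<beta> \<gamma>) vs"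
proof (induction vs arbitrary: k \<beta> \<gamma>)
  case (Cons v vs)
  have "homogeneous (k - 1) (interior_product v \<beta>)"
    using Cons.prems by (cases k) (auto simp: homogeneous_def interior_product_def)
  then have 1: "wedge (cwedge a (interior_product v \<beta>)) \<gamma> vs = cwedge a (wedge (interior_product v \<beta>) \<gamma>) vs"
    by (rule Cons.IH)
  have 2: "wedge (cwedge a \<beta>) (interior_product v \<gamma>) vs = cwedge a (wedge \<beta> (interior_product v \<gamma>)) vs"
    by (rule Cons.IH[OF Cons.prems])
  have 3: "interior_product v (wedge \<beta> \<gamma>)
      = wedge (interior_product v \<beta>) \<gamma> + scale_form ((-1) ^ k) (wedge \<beta> (interior_product v \<gamma>))"
    by (rule ext) (simp add: interior_apply wedge_rec[OF Cons.prems] scale_form_apply)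
  show ?case
    by (simp add: wedge_rec[OF homogeneous_cwedge[OF Cons.prems]] interior_cwedge wedge_linear
        cwedge_rec 3 cwedge_linear 1 2 scale_form_apply)
qed (simp add: wedge_Nil cwedge_Nil)

lemma wedge_cwedge: "homogeneous k \<beta> \<Longrightarrow> wedge (cwedge a \<beta>) \<gamma> = cwedge a (wedge \<beta> \<gamma>)"
  using wedge_cwedge_aux by blast

lemma homogeneous_basis_form: "homogeneous (length is) (basis_form e is)"
proof (induction "is")
  case Nil
  then show ?case by (simp add: homogeneous_def)
next
  case (Cons i "is")
  then show ?case
    using homogeneous_cwedge unfolding basis_form_Cons by fastforce
qed

lemma wedge_basis_form: "wedge (basis_form e is) (basis_form e js) = basis_form e (is @ js)"
proof (induction "is")
  case Nil
  then show ?case by (auto simp: wedge_unit)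
next
  case (Cons i "is")
  have "wedge (basis_form e (i # is)) (basis_form e js)
      = cwedge (dual_basis e i) (wedge (basis_form e is) (basis_form e js))"
    unfolding basis_form_Cons by (rule wedge_cwedge[OF homogeneous_basis_form])
  then show ?case
    unfolding Cons append_Cons basis_form_Cons .
qed


section \<open>Multilinear and alternating forms\<close>

text \<open>Both conditions are imposed on lists of every length. This costs nothing for a homogeneous form
  and makes them stable under interior products without a degree argument.\<close>

definition multilinear :: "form \<Rightarrow> bool" where
  "multilinear \<alpha> \<longleftrightarrow> (\<forall>us ws. linear (\<lambda>v. \<alpha> (us @ v # ws)))"

definition alternating :: "form \<Rightarrow> bool" where
  "alternating \<alpha> \<longleftrightarrow> (\<forall>us v w ws. \<alpha> (us @ v # w # ws) = - \<alpha> (us @ w # v # ws))"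

lemma multilinear_linear: "multilinear \<alpha> \<Longrightarrow> linear (\<lambda>v. \<alpha> (us @ v # ws))"
  by (simp add: multilinear_def)

lemma multilinear_linear_hd: "multilinear \<alpha> \<Longrightarrow> linear (\<lambda>v. \<alpha> (v # ws))"
  using multilinear_linear[of \<alpha> "[]"] by simp

lemma multilinear_interior: "multilinear \<alpha> \<Longrightarrow> multilinear (interior_product v \<alpha>)"
  unfolding multilinear_def interior_product_def append_Cons[symmetric] by blast

lemma multilinear_append: "multilinear \<alpha> \<Longrightarrow> multilinear (\<lambda>vs. \<alpha> (vs @ ws))"
  by (simp add: multilinear_def)

lemma multilinear_unit: "multilinear unit_form"
  by (simp add: multilinear_def module_hom_zero)

lemma linear_cwedge_form:
  "(\<And>vs. linear (\<lambda>v. G v vs)) \<Longrightarrow> linear (\<lambda>v. cwedge a (G v) ws)"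
proof (induction ws arbitrary: G)
  case Nil
  then show ?case by (simp add: cwedge_Nil module_hom_zero)
next
  case (Cons w ws)
  have "linear (\<lambda>v. cwedge a (interior_product w (G v)) ws)"
    using Cons by (simp add: interior_product_def)
  with Cons.prems show ?case
    by (auto simp: cwedge_rec intro!: linear_compose_sub linear_compose_scale_right[where 'b=real, simplified])
qed

lemma multilinear_cwedge:
  assumes "linear a" "multilinear \<beta>"
  shows "multilinear (cwedge a \<beta>)"
proof -
  have "linear (\<lambda>v. cwedge a \<beta> (us @ v # ws))" if "multilinear \<beta>" for us ws \<beta>
    using that
  proof (induction us arbitrary: \<beta>)
    case Nil
    have "linear (\<lambda>v. cwedge a (interior_product v \<beta>) ws)"
      using Nil by (intro linear_cwedge_form) (simp add: interior_product_def multilinear_linear_hd)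
    with assms(1) show ?case
      by (auto simp: cwedge_rec linear_iff algebra_simps)
  next
    case (Cons u us)
    then show ?case
      using multilinear_linear[OF Cons.prems, of us] Cons.IH[OF multilinear_interior[OF Cons.prems, of u]]
      by (auto simp: cwedge_rec linear_iff algebra_simps)
  qed
  with assms(2) show ?thesis by (simp add: multilinear_def)
qed

lemma alternating_interior:
  assumes "alternating \<alpha>"
  shows "alternating (interior_product x \<alpha>)"
proof -
  have "\<alpha> ((x # us) @ v # w # ws) = - \<alpha> ((x # us) @ w # v # ws)" for us v w ws
    using assms unfolding alternating_def by blast
  then show ?thesis
    unfolding alternating_def interior_product_def append_Cons by blast
qed

lemma alternating_append: "alternating \<alpha> \<Longrightarrow> alternating (\<lambda>vs. \<alpha> (vs @ ws))"
  unfolding alternating_def append_assoc append_Cons by blast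

lemma interior_interior:
  assumes "alternating \<alpha>"
  shows "interior_product v (interior_product w \<alpha>) = - interior_product w (interior_product v \<alpha>)"
proof
  fix ws
  have "\<alpha> ([] @ w # v # ws) = - \<alpha> ([] @ v # w # ws)"
    using assms unfolding alternating_def by blast
  then show "interior_product v (interior_product w \<alpha>) ws = (- interior_product w (interior_product v \<alpha>)) ws"
    by (simp add: interior_product_def)
qed

lemma alternating_cwedge:
  assumes "alternating \<beta>"
  shows "alternating (cwedge a \<beta>)"
proof -
  have "cwedge a \<beta> (us @ v # w # ws) = - cwedge a \<beta> (us @ w # v # ws)" if "alternating \<beta>" for us v w ws \<beta>
    using that
  proof (induction us arbitrary: \<beta>)
    case Nil
    show ?case
      by (simp add: cwedge_rec interior_cwedge interior_apply interior_interior[OF Nil, of w v] cwedge_linear)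
  next
    case (Cons u us)
    have "\<beta> (us @ v # w # ws) = - \<beta> (us @ w # v # ws)"
      using Cons.prems unfolding alternating_def by blast
    then show ?case
      using Cons.IH[OF alternating_interior[OF Cons.prems, of u]] by (simp add: cwedge_rec)
  qed
  with assms show ?thesis unfolding alternating_def by blast
qed

lemma multilinear_basis_form: "is_basis e \<Longrightarrow> multilinear (basis_form e is)"
proof (induction "is")
  case (Cons i "is")
  then show ?case
    unfolding basis_form_Cons by (intro multilinear_cwedge linear_dual_basis)
qed (simp add: multilinear_unit)

lemma alternating_basis_form: "alternating (basis_form e is)"
proof (induction "is")
  case (Cons i "is")
  then show ?case
    unfolding basis_form_Cons by (rule alternating_cwedge)
qed (simp add: alternating_def)

lemma multilinear_add: "multilinear \<alpha> \<Longrightarrow> multilinear \<beta> \<Longrightarrow> multilinear (\<alpha> + \<beta>)"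
  by (simp add: multilinear_def linear_compose_add)

lemma multilinear_scale: "multilinear \<alpha> \<Longrightarrow> multilinear (scale_form c \<alpha>)"
  by (auto simp: multilinear_def linear_iff scale_form_def algebra_simps)

lemma multilinear_minus: "multilinear \<alpha> \<Longrightarrow> multilinear (- \<alpha>)"
  unfolding minus_form_eq by (rule multilinear_scale)

lemma multilinear_diff: "multilinear \<alpha> \<Longrightarrow> multilinear \<beta> \<Longrightarrow> multilinear (\<alpha> - \<beta>)"
  unfolding diff_form_eq by (intro multilinear_add multilinear_scale)

text \<open>A basis form sees its arguments only through their coordinates. Special cases are pullbacks by
  linear maps, changes of frame, and rescaling of the basis by \<open>1 / r\<close>.\<close>

lemma basis_form_map:
  assumes "\<And>i x. x \<in> set xs \<Longrightarrow> dual_basis e i (p x) = r * dual_basis e' i (q x)"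
  shows "basis_form e is (map p xs) = r ^ length is * basis_form e' is (map q xs)"
  using assms
proof (induction "is" arbitrary: xs)
  case (Cons i "is")
  have a: "covector (dual_basis e i) (map p (nths xs S)) = r * covector (dual_basis e' i) (map q (nths xs S))" for S
    using Cons.prems set_nths_subset[of xs S] by (cases "nths xs S") (auto simp: covector_def)
  have b: "basis_form e is (map p (nths xs S)) = r ^ length is * basis_form e' is (map q (nths xs S))" for S
    using Cons.prems set_nths_subset[of xs S] by (intro Cons.IH) blast
  show ?case
    unfolding basis_form_Cons cwedge_def wedge_def nths_map a b
    by (simp add: sum_distrib_left mult_ac)
qed simp


section \<open>Orthonormal bases and the Hodge star\<close>

text \<open>The unnormalised inner product of alternating \<open>k\<close>-forms for which \<open>e\<close> is orthonormal: every increasing index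
  list is counted \<open>k!\<close> times.\<close>

definition pairing :: "nat \<Rightarrow> (7 \<Rightarrow> vec7) \<Rightarrow> form \<Rightarrow> form \<Rightarrow> real" where
  "pairing k e \<alpha> \<beta> = (\<Sum>is | length is = k. \<alpha> (map e is) * \<beta> (map e is))"

lemma sum_lists_Suc:
  "(\<Sum>is | length is = Suc k. f is) = (\<Sum>i\<in>UNIV. \<Sum>is | length is = k. f (i # is))"
proof -
  have S: "{is. length is = Suc k} = (\<lambda>(i, is). i # is) ` (UNIV \<times> {is. length is = k})"
    by (auto simp: length_Suc_conv image_iff)
  have I: "inj_on (\<lambda>(i, is). i # is) (UNIV \<times> {is. length is = k})"
    by (auto simp: inj_on_def)
  have "(\<Sum>is | length is = Suc k. f is) = (\<Sum>(i, is)\<in>UNIV \<times> {is. length is = k}. f (i # is))"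
    unfolding S sum.reindex[OF I] by (simp add: case_prod_beta')
  then show ?thesis
    by (simp add: sum.cartesian_product)
qed

lemma pairing_0: "pairing 0 e \<alpha> \<beta> = \<alpha> [] * \<beta> []"
  by (simp add: pairing_def)

lemma pairing_Suc:
  "pairing (Suc k) e \<alpha> \<beta> = (\<Sum>i\<in>UNIV. pairing k e (interior_product (e i) \<alpha>) (interior_product (e i) \<beta>))"
  by (simp add: pairing_def sum_lists_Suc interior_product_def)

lemma pairing_linear:
  "pairing k e (\<alpha> + \<alpha>') \<beta> = pairing k e \<alpha> \<beta> + pairing k e \<alpha>' \<beta>"
  "pairing k e (\<alpha> - \<alpha>') \<beta> = pairing k e \<alpha> \<beta> - pairing k e \<alpha>' \<beta>"
  "pairing k e (scale_form c \<alpha>) \<beta> = c * pairing k e \<alpha> \<beta>"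
  "pairing k e \<alpha> (- \<beta>) = - pairing k e \<alpha> \<beta>"
  by (simp_all add: pairing_def scale_form_def algebra_simps sum.distrib sum_subtractf sum_distrib_left sum_negf)

lemma inner_prod_linear:
  assumes "inner_prod g" shows "linear (g x)" "linear (\<lambda>x. g x y)"
  using assms by (auto simp: inner_prod_def bilinear_def)

lemma dual_basis_orthonormal:
  assumes "inner_prod g" "orthonormal_basis g e"
  shows "dual_basis e i v = g (e i) v"
proof -
  have e: "is_basis e" using assms(2) by (simp add: orthonormal_basis_def)
  show ?thesis
    using assms(2) linear_expansion[OF e inner_prod_linear(1)[OF assms(1)], of "e i" v]
    by (simp add: orthonormal_basis_def if_distrib[of "\<lambda>x. _ * x"] cong: if_cong)
qed

text \<open>The trace of a bilinear form with respect to an inner product does not depend on the orthonormal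
  basis. Applied to one argument after the other, it makes the pairing of forms independent of the
  basis, and with it the Hodge star, whose definition chooses an arbitrary one.\<close>

lemma trace_orthonormal:
  fixes B :: "vec7 \<Rightarrow> vec7 \<Rightarrow> real"
  assumes g: "inner_prod g" and e: "orthonormal_basis g e" and e': "orthonormal_basis g e'"
    and B: "\<And>v. linear (B v)" "\<And>w. linear (\<lambda>v. B v w)"
  shows "(\<Sum>i\<in>UNIV. B (e i) (e i)) = (\<Sum>j\<in>UNIV. B (e' j) (e' j))"
proof -
  have be: "is_basis e" "is_basis e'" using e e' by (auto simp: orthonormal_basis_def)
  have sym: "g x y = g y x" for x y using g by (simp add: inner_prod_def)
  have exp: "B v w = (\<Sum>j\<in>UNIV. \<Sum>k\<in>UNIV. g (e' j) v * g (e' k) w * B (e' j) (e' k))" for v w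
  proof -
    have "B v w = (\<Sum>j\<in>UNIV. g (e' j) v * B (e' j) w)"
      using linear_expansion[OF be(2) B(2), of v w] by (simp add: dual_basis_orthonormal[OF g e'])
    moreover have "B (e' j) w = (\<Sum>k\<in>UNIV. g (e' k) w * B (e' j) (e' k))" for j
      using linear_expansion[OF be(2) B(1), of "e' j" w] by (simp add: dual_basis_orthonormal[OF g e'])
    ultimately show ?thesis
      by (simp add: sum_distrib_left mult.assoc)
  qed
  have par: "(\<Sum>i\<in>UNIV. g (e' j) (e i) * g (e' k) (e i)) = (if j = k then 1 else 0)" for j k
  proof -
    have "g (e' j) (e' k) = (\<Sum>i\<in>UNIV. g (e' j) (e i) * g (e' k) (e i))"
      using linear_expansion[OF be(1) inner_prod_linear(1)[OF g], of "e' j" "e' k"]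
      by (simp add: dual_basis_orthonormal[OF g e] sym mult.commute)
    then show ?thesis using e' by (simp add: orthonormal_basis_def)
  qed
  have "(\<Sum>i\<in>UNIV. B (e i) (e i))
      = (\<Sum>i\<in>UNIV. \<Sum>j\<in>UNIV. \<Sum>k\<in>UNIV. g (e' j) (e i) * g (e' k) (e i) * B (e' j) (e' k))"
    by (rule sum.cong) (simp_all add: exp[of "e _"])
  also have "\<dots> = (\<Sum>j\<in>UNIV. \<Sum>k\<in>UNIV. \<Sum>i\<in>UNIV. g (e' j) (e i) * g (e' k) (e i) * B (e' j) (e' k))"
    by (subst sum.swap, rule sum.cong, simp, subst sum.swap, simp)
  also have "\<dots> = (\<Sum>j\<in>UNIV. \<Sum>k\<in>UNIV. (if j = k then 1 else 0) * B (e' j) (e' k))"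
    by (simp add: sum_distrib_right[symmetric] par)
  also have "\<dots> = (\<Sum>j\<in>UNIV. B (e' j) (e' j))"
    by (simp add: if_distrib[of "\<lambda>x. x * _"] cong: if_cong)
  finally show ?thesis .
qed

lemma linear_pairing:
  assumes "multilinear \<beta>"
  shows "linear (\<lambda>v. pairing k e (interior_product v \<beta>) \<gamma>)" "linear (\<lambda>v. pairing k e \<gamma> (interior_product v \<beta>))"
  using multilinear_linear_hd[OF assms]
  by (auto simp: linear_iff pairing_def interior_product_def algebra_simps sum.distrib sum_distrib_left)

lemma pairing_orthonormal:
  assumes g: "inner_prod g" and e: "orthonormal_basis g e" and e': "orthonormal_basis g e'"
  shows "multilinear \<alpha> \<Longrightarrow> multilinear \<beta> \<Longrightarrow> pairing k e \<alpha> \<beta> = pairing k e' \<alpha> \<beta>"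
proof (induction k arbitrary: \<alpha> \<beta>)
  case (Suc k)
  show ?case
    unfolding pairing_Suc
    using trace_orthonormal[OF g e e',
        of "\<lambda>v w. pairing k e' (interior_product v \<alpha>) (interior_product w \<beta>)"]
    by (simp add: Suc multilinear_interior linear_pairing)
qed (simp add: pairing_0)

lemma hodge_orthonormal:
  assumes "inner_prod g" "orthonormal_basis g e" "multilinear \<alpha>" "multilinear vol"
  shows "hodge g vol \<alpha> ws = 1 / fact (7 - length ws) * pairing (7 - length ws) e \<alpha> (\<lambda>vs. vol (vs @ ws))"
proof -
  have "orthonormal_basis g (SOME e. orthonormal_basis g e)"
    using assms(2) by (metis someI)
  from pairing_orthonormal[OF assms(1) this assms(2,3) multilinear_append[OF assms(4), of ws]]
  show ?thesis
    by (simp add: hodge_def Let_def pairing_def)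
qed

lemma hodge_linear:
  "hodge g vol (\<alpha> + \<beta>) = hodge g vol \<alpha> + hodge g vol \<beta>"
  "hodge g vol (\<alpha> - \<beta>) = hodge g vol \<alpha> - hodge g vol \<beta>"
  "hodge g vol (- \<alpha>) = - hodge g vol \<alpha>"
  "hodge g vol 0 = 0"
  "hodge g vol (scale_form c \<alpha>) = scale_form c (hodge g vol \<alpha>)"
  by (rule ext, simp add: hodge_def Let_def scale_form_def algebra_simps sum.distrib sum_subtractf
      sum_distrib_left sum_negf add_divide_distrib diff_divide_distrib)+

text \<open>For the metric that makes \<open>e\<close> orthonormal, exterior multiplication by a covector of the dual basis is
  adjoint to the interior product with the corresponding vector. The factor \<open>k + 1\<close> comes from counting each increasing list \<open>(k + 1)!\<close> times on
  the left and \<open>k!\<close> times on the right.\<close>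

lemma pairing_cwedge:
  assumes e: "is_basis e"
  shows "alternating \<gamma> \<Longrightarrow> pairing (Suc k) e (cwedge (dual_basis e i) \<beta>) \<gamma>
    = real (Suc k) * pairing k e \<beta> (interior_product (e i) \<gamma>)"
proof (induction k arbitrary: \<beta> \<gamma>)
  case 0
  show ?case
    by (simp add: pairing_Suc pairing_0 interior_apply cwedge_rec cwedge_Nil dual_basis_self[OF e]
        if_distrib[of "\<lambda>x. x * _"] cong: if_cong)
next
  case (Suc k)
  have "pairing (Suc (Suc k)) e (cwedge (dual_basis e i) \<beta>) \<gamma>
      = (\<Sum>j\<in>UNIV. dual_basis e i (e j) * pairing (Suc k) e \<beta> (interior_product (e j) \<gamma>)
           - pairing (Suc k) e (cwedge (dual_basis e i) (interior_product (e j) \<beta>)) (interior_product (e j) \<gamma>))"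
    unfolding pairing_Suc[of "Suc k"] interior_cwedge pairing_linear ..
  also have "\<dots> = pairing (Suc k) e \<beta> (interior_product (e i) \<gamma>)
      - (\<Sum>j\<in>UNIV. real (Suc k) * pairing k e (interior_product (e j) \<beta>) (interior_product (e i) (interior_product (e j) \<gamma>)))"
    by (simp add: sum_subtractf dual_basis_self[OF e] Suc.IH[OF alternating_interior[OF Suc.prems]]
        if_distrib[of "\<lambda>x. x * _"] cong: if_cong)
  also have "\<dots> = pairing (Suc k) e \<beta> (interior_product (e i) \<gamma>)
      + real (Suc k) * pairing (Suc k) e \<beta> (interior_product (e i) \<gamma>)"
    by (subst interior_interior[OF Suc.prems])
       (simp add: pairing_linear sum_negf pairing_Suc[of k e \<beta>] sum_distrib_left)
  finally show ?case by (simp add: algebra_simps)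
qed

lemma pairing_basis_form:
  assumes e: "is_basis e"
  shows "alternating \<gamma> \<Longrightarrow> pairing (length is) e (basis_form e is) \<gamma> = fact (length is) * \<gamma> (map e is)"
proof (induction "is" arbitrary: \<gamma>)
  case (Cons i "is")
  show ?case
    unfolding length_Cons basis_form_Cons pairing_cwedge[OF e Cons.prems]
      Cons.IH[OF alternating_interior[OF Cons.prems]]
    by (simp add: interior_apply)
qed (simp add: pairing_0)

lemma basis_form_wrong_length: "length vs \<noteq> length is \<Longrightarrow> basis_form e is vs = 0"
  using homogeneous_basis_form[of "is" e] by (simp add: homogeneous_def)

lemma interiors_apply: "fold (\<lambda>i. interior_product (e i)) is \<alpha> ws = \<alpha> (map e is @ ws)"
  by (induction "is" arbitrary: \<alpha>) (simp_all add: interior_apply)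

text \<open>Moving the covectors of a basis form one by one across the pairing contracts the volume form with
  the dual vectors, and these contractions can be computed by rewriting.\<close>

lemma hodge_basis_form:
  assumes g: "inner_prod g" "orthonormal_basis g e" and js: "length js = 7"
  shows "hodge g (basis_form e js) (basis_form e is)
    = fold (\<lambda>i. interior_product (e i)) is (basis_form e js)"
proof
  fix ws
  have e: "is_basis e" using g(2) by (simp add: orthonormal_basis_def)
  note m = multilinear_basis_form[OF e]
  show "hodge g (basis_form e js) (basis_form e is) ws
    = fold (\<lambda>i. interior_product (e i)) is (basis_form e js) ws"
  proof (cases "length is = 7 - length ws")
    case True
    show ?thesis
      unfolding hodge_orthonormal[OF g m m] True[symmetric]
        pairing_basis_form[OF e alternating_append[OF alternating_basis_form]] interiors_apply
      by simp
  next
    case False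
    then have "basis_form e js (map e is @ ws) = 0"
      using js by (intro basis_form_wrong_length) auto
    moreover have "pairing (7 - length ws) e (basis_form e is) \<gamma> = 0" for \<gamma>
      unfolding pairing_def using False by (intro sum.neutral) (auto simp: basis_form_wrong_length)
    ultimately show ?thesis
      unfolding hodge_orthonormal[OF g m m] interiors_apply by simp
  qed
qed


section \<open>Uniqueness of the metric and the volume form\<close>

lemma basis_form_self:
  assumes "is_basis e"
  shows "basis_form e [1,2,3,4,5,6,7] (map e [1,2,3,4,5,6,7]) = 1"
proof -
  have 0: "scale_form 0 \<alpha> = 0" for \<alpha> by (auto simp: scale_form_def)
  show ?thesis
    by (simp add: basis_form_Cons cwedge_rec interior_cwedge dual_basis_self[OF assms] cwedge_linear
        interior_linear interior_unit 0)
qed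

text \<open>The two metrics and volume forms satisfy \<open>g \<otimes> vol = g' \<otimes> vol'\<close>, so \<open>vol = t vol'\<close> and \<open>g' = t g\<close> for a
  single \<open>t > 0\<close>. If \<open>e\<close> is orthonormal for \<open>g\<close>, then \<open>e / sqrt t\<close> is orthonormal for \<open>g'\<close>. The squared norm
  \<open>N\<close> of a volume form with respect to its own metric is the same number for both. Evaluated on the
  rescaled basis, the norm of \<open>vol'\<close> is \<open>t\<^sup>-\<^sup>9 N\<close>: a factor \<open>t\<^sup>-\<^sup>2\<close> for \<open>vol' = t\<^sup>-\<^sup>1 vol\<close> and a factor \<open>t\<^sup>-\<^sup>7\<close> for the
  fourteen arguments. Hence \<open>t = 1\<close>, and the orientation is determined as well.\<close>

lemma g2_induces_unique:
  assumes 1: "g2_induces \<phi> g vol" and 2: "g2_induces \<phi> g' vol'"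
  shows "g = g' \<and> vol = vol'"
proof -
  let ?I = "[1,2,3,4,5,6,7] :: 7 list"
  obtain e where g: "inner_prod g" and e: "orthonormal_basis g e" and vol: "vol = basis_form e ?I"
    using 1 by (auto simp: g2_induces_def)
  obtain e' where g': "inner_prod g'" and e': "orthonormal_basis g' e'" and vol': "vol' = basis_form e' ?I"
    using 2 by (auto simp: g2_induces_def)
  have be: "is_basis e" "is_basis e'"
    using e e' by (auto simp: orthonormal_basis_def)
  have eq: "g X Y * vol vs = g' X Y * vol' vs" for X Y vs
  proof -
    let ?w = "1 / 6 * wedge (wedge (interior_product X \<phi>) (interior_product Y \<phi>)) \<phi> vs"
    have "g X Y * vol vs = ?w" using 1 unfolding g2_induces_def by blast
    moreover have "g' X Y * vol' vs = ?w" using 2 unfolding g2_induces_def by blast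
    ultimately show ?thesis by simp
  qed
  define t where "t = g' (e 1) (e 1)"
  have "e 1 \<noteq> 0"
    using dual_basis_self[OF be(1), of 1 1] linear_0[OF linear_dual_basis[OF be(1)]] by force
  then have t: "t > 0"
    using g' by (simp add: t_def inner_prod_def)
  have vt: "vol vs = t * vol' vs" for vs
    using eq[of "e 1" "e 1" vs] e by (simp add: t_def orthonormal_basis_def)
  have "g X Y = g' X Y * vol' (map e ?I)" for X Y
    using eq[of X Y "map e ?I"] basis_form_self[OF be(1)] by (simp only: vol mult_1_right)
  moreover have "vol' (map e ?I) = 1 / t"
    using vt[of "map e ?I"] basis_form_self[OF be(1)] t by (simp add: vol field_simps del: list.map)
  ultimately have gt: "g' X Y = t * g X Y" for X Y
    using t by simp
  define c where "c = 1 / sqrt t"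
  define u where "u i = c *\<^sub>R e i" for i
  have c: "c > 0" "c\<^sup>2 = 1 / t" using t by (auto simp: c_def power_divide)
  have gu: "g' (u i) (u j) = (if i = j then 1 else 0)" for i j
  proof -
    have "g' (u i) (u j) = c\<^sup>2 * g' (e i) (e j)"
      by (simp add: u_def linear_cmul[OF inner_prod_linear(1)[OF g']]
          linear_cmul[OF inner_prod_linear(2)[OF g']] power2_eq_square)
    then show ?thesis
      using e t by (simp add: gt c orthonormal_basis_def)
  qed
  have "is_basis u"
    by (rule biorthogonal_imp_dual_basis(1)[of "\<lambda>i. g' (u i)", OF inner_prod_linear(1)[OF g'] gu])
  then have u: "orthonormal_basis g' u"
    using gu by (simp add: orthonormal_basis_def)
  define N where "N = pairing 7 e vol vol"
  have N: "pairing 7 e' vol' vol' = N"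
    unfolding N_def pairing_def vol vol'
    using basis_form_map[of _ e' e' 1 e e ?I] dual_basis_self[OF be(1)] dual_basis_self[OF be(2)] by simp
  have "N \<noteq> 0"
  proof -
    have "(vol (map e ?I))\<^sup>2 \<le> N"
      unfolding N_def pairing_def power2_eq_square
      by (rule member_le_sum) (use finite_lists_length_eq[of "UNIV :: 7 set" 7] in auto)
    then show ?thesis
      using basis_form_self[OF be(1)] unfolding vol by simp
  qed
  have "N = pairing 7 u vol' vol'"
    unfolding N[symmetric] vol' using pairing_orthonormal[OF g' e' u] multilinear_basis_form[OF be(2)] by blast
  also have "\<dots> = pairing 7 e (scale_form (c ^ 7) vol') (scale_form (c ^ 7) vol')"
  proof -
    have "basis_form e' ?I (map u is) = c ^ 7 * basis_form e' ?I (map e is)" for "is"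
      using basis_form_map[of "is" e' u c e' e ?I] by (simp add: u_def linear_cmul[OF linear_dual_basis[OF be(2)]] eval_nat_numeral)
    then show ?thesis
      by (simp add: pairing_def vol' scale_form_def)
  qed
  also have "\<dots> = (c ^ 2) ^ 9 * N"
  proof -
    have "vol' = scale_form (c\<^sup>2) vol"
      using t by (auto simp: vt c scale_form_def)
    then show ?thesis
      by (simp add: N_def pairing_def scale_form_def sum_distrib_left mult_ac power_mult_distrib) 
  qed
  finally have "(c ^ 2) ^ 9 = 1"
    using \<open>N \<noteq> 0\<close> by simp
  then have "t = 1"
    using power_eq_imp_eq_base[of "c\<^sup>2" 9 1] c t by simp
  with vt gt show ?thesis by (auto simp: fun_eq_iff)
qed

lemma g2_metric_vol_eqI:
  assumes "g2_induces \<phi> g vol"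
  shows "g2_metric \<phi> = g" "g2_vol \<phi> = vol"
  unfolding g2_metric_def g2_vol_def
  using assms g2_induces_unique by blast+


section \<open>The metric and the star of the model form\<close>

text \<open>An explicit numbering makes the order of literal indices decidable by rewriting, so that
  \<open>cwedge_sort\<close> and \<open>cwedge_same\<close> bring every basis form to its normal form.\<close>

definition position :: "7 \<Rightarrow> nat" where
  "position i = (if i = 1 then 1 else if i = 2 then 2 else if i = 3 then 3 else if i = 4 then 4
     else if i = 5 then 5 else if i = 6 then 6 else 7)"

lemma position_simps:
  "position 1 = 1" "position 2 = 2" "position 3 = 3" "position 4 = 4"
  "position 5 = 5" "position 6 = 6" "position 7 = 7"
  by (simp_all add: position_def)

lemma cwedge_sort:
  "position j < position i \<Longrightarrow> cwedge (dual_basis e i) (cwedge (dual_basis e j) \<beta>)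
     = - cwedge (dual_basis e j) (cwedge (dual_basis e i) \<beta>)"
  by (rule cwedge_swap)

lemma scale_form_0_1: "scale_form 0 \<alpha> = 0" "scale_form 1 \<alpha> = \<alpha>"
  by (auto simp: scale_form_def)

lemmas normal_form = basis_form_Cons cwedge_sort position_simps cwedge_same cwedge_linear

definition frame_metric :: "(7 \<Rightarrow> vec7) \<Rightarrow> vec7 \<Rightarrow> vec7 \<Rightarrow> real" where
  "frame_metric e x y = (\<Sum>i\<in>UNIV. dual_basis e i x * dual_basis e i y)"

abbreviation frame_volume :: "(7 \<Rightarrow> vec7) \<Rightarrow> form" where
  "frame_volume e \<equiv> basis_form e [1, 2, 3, 4, 5, 6, 7]"

lemma phi12_eq: "phi12 e = - basis_form e [1,2,4] + basis_form e [1,3,5] + basis_form e [1,6,7]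
   - basis_form e [2,3,6] + basis_form e [2,5,7] + basis_form e [3,4,7] - basis_form e [4,5,6]"
  by (rule ext) (simp add: phi12_def)

context
  fixes e :: "7 \<Rightarrow> vec7"
  assumes e: "is_basis e"
begin

lemma linear_frame_metric: "linear (frame_metric e x)" "linear (\<lambda>x. frame_metric e x y)"
  using linear_dual_basis[OF e]
  by (auto simp: frame_metric_def linear_iff algebra_simps sum.distrib sum_distrib_left)

lemma frame_metric_basis: "frame_metric e (e i) y = dual_basis e i y"
  by (simp add: frame_metric_def dual_basis_self[OF e] if_distrib[of "\<lambda>x. x * _"] cong: if_cong)

lemma inner_prod_frame_metric: "inner_prod (frame_metric e)"
  unfolding inner_prod_def
proof (intro conjI allI impI)
  show "bilinear (frame_metric e)"
    by (simp add: bilinear_def linear_frame_metric)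
  show "frame_metric e x y = frame_metric e y x" for x y
    by (simp add: frame_metric_def mult.commute)
  fix x :: vec7 assume "x \<noteq> 0"
  then obtain i where "dual_basis e i x \<noteq> 0"
    using basis_expansion[OF e, of x] by force
  then show "frame_metric e x x > 0"
    unfolding frame_metric_def by (intro sum_pos2[of _ i]) (auto simp: zero_less_mult_iff)
qed

lemma orthonormal_frame_metric: "orthonormal_basis (frame_metric e) e"
  by (simp add: orthonormal_basis_def e frame_metric_basis dual_basis_self[OF e])

lemma multilinear_phi12: "multilinear (phi12 e)"
  unfolding phi12_eq by (intro multilinear_add multilinear_diff multilinear_minus multilinear_basis_form e)

lemma interior_frame:
  "interior_product (e i) (basis_form e []) = 0"
  "interior_product (e i) (cwedge (dual_basis e j) \<beta>)
    = (if i = j then \<beta> else 0) - cwedge (dual_basis e j) (interior_product (e i) \<beta>)"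
  by (simp_all add: interior_unit interior_cwedge dual_basis_self[OF e] scale_form_0_1)

text \<open>Each index lies on three of the seven triples of \<open>\<phi>\<^sub>1\<^sub>2\<close>, which form a Fano plane.\<close>

lemma interior_phi12:
  "interior_product (e 1) (phi12 e) = - basis_form e [2,4] + basis_form e [3,5] + basis_form e [6,7]"
  "interior_product (e 2) (phi12 e) = basis_form e [1,4] - basis_form e [3,6] + basis_form e [5,7]"
  "interior_product (e 3) (phi12 e) = - basis_form e [1,5] + basis_form e [2,6] + basis_form e [4,7]"
  "interior_product (e 4) (phi12 e) = - basis_form e [1,2] - basis_form e [3,7] - basis_form e [5,6]"
  "interior_product (e 5) (phi12 e) = basis_form e [1,3] - basis_form e [2,7] + basis_form e [4,6]"
  "interior_product (e 6) (phi12 e) = - basis_form e [1,7] - basis_form e [2,3] - basis_form e [4,5]"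
  "interior_product (e 7) (phi12 e) = basis_form e [1,6] + basis_form e [2,5] + basis_form e [3,4]"
  unfolding phi12_eq
  by (simp_all add: interior_linear interior_frame cwedge_linear basis_form_Cons del: basis_form.simps(1))

text \<open>That the frame is orthonormal and positively oriented for \<open>\<phi>\<^sub>1\<^sub>2\<close> is a finite computation with
  products of basis forms, brought to normal form by sorting the indices.\<close>

lemma phi12_cubic_form_basis:
  "wedge (wedge (interior_product (e i) (phi12 e)) (interior_product (e j) (phi12 e))) (phi12 e)
   = scale_form (if i = j then 6 else 0) (frame_volume e)"
proof -
  have "\<forall>i j. wedge (wedge (interior_product (e i) (phi12 e)) (interior_product (e j) (phi12 e))) (phi12 e)
      = scale_form (if i = j then 6 else 0) (frame_volume e)"
    unfolding forall_7 interior_phi12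
    unfolding phi12_eq
    apply (intro conjI)
    apply (simp_all only: wedge_linear wedge_basis_form append.simps)
    apply (simp_all add: normal_form scale_form_0_1 del: basis_form.simps(1))
    apply (simp_all add: fun_eq_iff scale_form_def)
    done
  then show ?thesis by blast
qed

lemma g2_induces_phi12: "g2_induces (phi12 e) (frame_metric e) (frame_volume e)"
  unfolding g2_induces_def
proof (intro conjI allI exI)
  fix X Y vs
  define B where "B X Y = wedge (wedge (interior_product X (phi12 e)) (interior_product Y (phi12 e))) (phi12 e) vs" for X Y
  have i: "interior_product (v + w) (phi12 e) = interior_product v (phi12 e) + interior_product w (phi12 e)"
    "interior_product (c *\<^sub>R v) (phi12 e) = scale_form c (interior_product v (phi12 e))" for v w c
    using multilinear_linear_hd[OF multilinear_phi12]
    by (auto simp: fun_eq_iff interior_product_def linear_iff scale_form_def)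
  have lin: "linear (B v)" "linear (\<lambda>v. B v w)" for v w
    by (auto simp: B_def linear_iff i wedge_linear scale_form_apply)
  have "B X Y = (\<Sum>i\<in>UNIV. \<Sum>j\<in>UNIV. dual_basis e i X * dual_basis e j Y * B (e i) (e j))"
    using linear_expansion[OF e lin(2), of X Y] linear_expansion[OF e lin(1), of "e _" Y]
    by (simp add: sum_distrib_left mult.assoc)
  also have "\<dots> = 6 * (frame_metric e X Y * frame_volume e vs)"
    by (simp add: B_def phi12_cubic_form_basis scale_form_apply frame_metric_def sum_distrib_left
        sum_distrib_right if_distrib[of "\<lambda>x. _ * x"] if_distrib[of "\<lambda>x. x * _"] mult_ac cong: if_cong)
  finally show "frame_metric e X Y * frame_volume e vs
      = 1 / 6 * wedge (wedge (interior_product X (phi12 e)) (interior_product Y (phi12 e))) (phi12 e) vs"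
    by (simp add: B_def)
qed (rule inner_prod_frame_metric orthonormal_frame_metric refl)+

lemmas g2_metric_phi12 = g2_metric_vol_eqI(1)[OF g2_induces_phi12]
  and g2_vol_phi12 = g2_metric_vol_eqI(2)[OF g2_induces_phi12]

lemma star_basis_form:
  "hodge (frame_metric e) (frame_volume e) (basis_form e is)
   = fold (\<lambda>i. interior_product (e i)) is (frame_volume e)"
  by (rule hodge_basis_form[OF inner_prod_frame_metric orthonormal_frame_metric]) simp

lemma star_phi12:
  "hodge (frame_metric e) (frame_volume e) (phi12 e)
   = basis_form e [3,5,6,7] - basis_form e [2,4,6,7] + basis_form e [2,3,4,5] + basis_form e [1,4,5,7]
     + basis_form e [1,3,4,6] + basis_form e [1,2,5,6] + basis_form e [1,2,3,7]"
  unfolding phi12_eq hodge_linear star_basis_form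
  by (simp add: interior_linear interior_frame cwedge_linear basis_form_Cons del: basis_form.simps(1))

lemma star_5_forms:
  "hodge (frame_metric e) (frame_volume e) (basis_form e [1,2,3,4,7]) = basis_form e [5,6]"
  "hodge (frame_metric e) (frame_volume e) (basis_form e [1,2,4,5,6]) = - basis_form e [3,7]"
  unfolding star_basis_form
  by (simp_all add: interior_linear interior_frame cwedge_linear basis_form_Cons del: basis_form.simps(1))

end


section \<open>Exterior and Lie derivatives of products\<close>

definition differentiable_form :: "form_field \<Rightarrow> bool" where
  "differentiable_form \<omega> \<longleftrightarrow> (\<forall>vs x. (\<lambda>y. \<omega> y vs) differentiable (at x))"

lemma differentiable_formD:
  assumes "differentiable_form \<omega>"
  shows "((\<lambda>y. \<omega> y vs) has_derivative frechet_derivative (\<lambda>y. \<omega> y vs) (at x)) (at x)"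
  using assms by (simp add: differentiable_form_def frechet_derivative_works[symmetric])

lemma differentiable_form_interior:
  "differentiable_form \<omega> \<Longrightarrow> differentiable_form (\<lambda>y. interior_product v (\<omega> y))"
  by (simp add: differentiable_form_def interior_product_def)

lemma differentiable_form_const: "differentiable_form (\<lambda>y. \<alpha>)"
  by (simp add: differentiable_form_def)

lemma differentiable_form_add:
  "differentiable_form \<alpha> \<Longrightarrow> differentiable_form \<beta> \<Longrightarrow> differentiable_form (\<lambda>y. \<alpha> y + \<beta> y)"
  by (simp add: differentiable_form_def)

lemma differentiable_form_diff:
  "differentiable_form \<alpha> \<Longrightarrow> differentiable_form \<beta> \<Longrightarrow> differentiable_form (\<lambda>y. \<alpha> y - \<beta> y)"
  by (simp add: differentiable_form_def)

lemma differentiable_form_scale: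
  assumes "\<And>x. g differentiable (at x)" "differentiable_form \<beta>"
  shows "differentiable_form (\<lambda>y. scale_form (g y) (\<beta> y))"
  using assms by (simp add: differentiable_form_def scale_form_def differentiable_mult)

lemma differentiable_form_minus: "differentiable_form \<alpha> \<Longrightarrow> differentiable_form (\<lambda>y. - \<alpha> y)"
  unfolding minus_form_eq by (intro differentiable_form_scale) auto

lemma has_derivative_cwedge:
  assumes a: "\<And>v. ((\<lambda>y. a y v) has_derivative (\<lambda>w. a' w v)) (at x)"
  shows "(\<And>vs. ((\<lambda>y. \<beta> y vs) has_derivative (\<lambda>w. \<beta>' w vs)) (at x)) \<Longrightarrow>
    ((\<lambda>y. cwedge (a y) (\<beta> y) vs) has_derivative
      (\<lambda>w. cwedge (a' w) (\<beta> x) vs + cwedge (a x) (\<beta>' w) vs)) (at x)"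
proof (induction vs arbitrary: \<beta> \<beta>')
  case Nil
  then show ?case by (simp add: cwedge_Nil)
next
  case (Cons v vs)
  have "((\<lambda>y. cwedge (a y) (interior_product v (\<beta> y)) vs) has_derivative
      (\<lambda>w. cwedge (a' w) (interior_product v (\<beta> x)) vs + cwedge (a x) (interior_product v (\<beta>' w)) vs)) (at x)"
    using Cons.prems by (intro Cons.IH) (simp add: interior_product_def)
  from has_derivative_diff[OF has_derivative_mult[OF a Cons.prems] this, of v vs] show ?case
    by (simp add: cwedge_rec algebra_simps)
qed

lemma differentiable_form_cwedge:
  assumes a: "\<And>v x. (\<lambda>y. a y v) differentiable (at x)" and \<beta>: "differentiable_form \<beta>"
  shows "differentiable_form (\<lambda>y. cwedge (a y) (\<beta> y))"
  unfolding differentiable_form_def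
proof (intro allI)
  fix vs x
  have "((\<lambda>y. a y v) has_derivative (\<lambda>w. frechet_derivative (\<lambda>y. a y v) (at x) w)) (at x)" for v
    using a by (simp add: frechet_derivative_works[symmetric])
  from has_derivative_cwedge[of a "\<lambda>w v. frechet_derivative (\<lambda>y. a y v) (at x) w" x \<beta>
      "\<lambda>w us. frechet_derivative (\<lambda>y. \<beta> y us) (at x) w", OF this differentiable_formD[OF \<beta>]]
  show "(\<lambda>y. cwedge (a y) (\<beta> y) vs) differentiable (at x)"
    by (rule differentiableI)
qed

lemma frechet_derivative_cwedge:
  assumes a: "\<And>v. (\<lambda>y. a y v) differentiable (at x)" and \<beta>: "differentiable_form \<beta>"
  shows "frechet_derivative (\<lambda>y. cwedge (a y) (\<beta> y) vs) (at x) w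
    = cwedge (\<lambda>v. frechet_derivative (\<lambda>y. a y v) (at x) w) (\<beta> x) vs
      + cwedge (a x) (\<lambda>us. frechet_derivative (\<lambda>y. \<beta> y us) (at x) w) vs"
proof -
  have "((\<lambda>y. a y v) has_derivative (\<lambda>w. frechet_derivative (\<lambda>y. a y v) (at x) w)) (at x)" for v
    using a by (simp add: frechet_derivative_works[symmetric])
  from has_derivative_cwedge[of a "\<lambda>w v. frechet_derivative (\<lambda>y. a y v) (at x) w" x \<beta>
      "\<lambda>w us. frechet_derivative (\<lambda>y. \<beta> y us) (at x) w", OF this differentiable_formD[OF \<beta>], of vs]
  show ?thesis
    by (rule fun_cong[OF frechet_derivative_at, symmetric])
qed

lemma frechet_derivative_scale:
  fixes g h :: "vec7 \<Rightarrow> real"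
  assumes "g differentiable (at x)" "h differentiable (at x)"
  shows "frechet_derivative (\<lambda>y. g y * h y) (at x) w
    = frechet_derivative g (at x) w * h x + g x * frechet_derivative h (at x) w"
proof -
  have "(g has_derivative frechet_derivative g (at x)) (at x)" "(h has_derivative frechet_derivative h (at x)) (at x)"
    using assms by (simp_all add: frechet_derivative_works[symmetric])
  from fun_cong[OF frechet_derivative_at[OF has_derivative_mult[OF this]], of w] show ?thesis
    by simp
qed

lemma frechet_derivative_linear_ops:
  fixes g h :: "vec7 \<Rightarrow> real"
  assumes "g differentiable (at x)" "h differentiable (at x)"
  shows "frechet_derivative (\<lambda>y. g y + h y) (at x) w = frechet_derivative g (at x) w + frechet_derivative h (at x) w"
    and "frechet_derivative (\<lambda>y. g y - h y) (at x) w = frechet_derivative g (at x) w - frechet_derivative h (at x) w"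
    and "frechet_derivative (\<lambda>y. c * h y) (at x) w = c * frechet_derivative h (at x) w"
proof -
  have d: "(g has_derivative frechet_derivative g (at x)) (at x)" "(h has_derivative frechet_derivative h (at x)) (at x)"
    using assms by (simp_all add: frechet_derivative_works[symmetric])
  show "frechet_derivative (\<lambda>y. g y + h y) (at x) w = frechet_derivative g (at x) w + frechet_derivative h (at x) w"
    by (rule fun_cong[OF frechet_derivative_at[OF has_derivative_add[OF d]], symmetric])
  show "frechet_derivative (\<lambda>y. g y - h y) (at x) w = frechet_derivative g (at x) w - frechet_derivative h (at x) w"
    by (rule fun_cong[OF frechet_derivative_at[OF has_derivative_diff[OF d]], symmetric])
  show "frechet_derivative (\<lambda>y. c * h y) (at x) w = c * frechet_derivative h (at x) w"
    by (rule fun_cong[OF frechet_derivative_at[OF has_derivative_mult_right[OF d(2)]], symmetric])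
qed

lemma ext_d_Nil: "ext_d \<omega> x [] = 0"
  by (simp add: ext_d_def)

text \<open>For a constant vector field \<open>v\<close> the Lie derivative is differentiation of the coefficients, so this
  is Cartan's formula. It reduces the Leibniz rules to inductions on the list of arguments.\<close>

lemma ext_d_rec:
  "ext_d \<omega> x (v # vs) = frechet_derivative (\<lambda>y. \<omega> y vs) (at x) v - ext_d (\<lambda>y. interior_product v (\<omega> y)) x vs"
  by (simp add: ext_d_def sum.lessThan_Suc_shift interior_product_def sum_negf del: sum.lessThan_Suc)

lemma ext_d_add:
  "differentiable_form \<alpha> \<Longrightarrow> differentiable_form \<beta> \<Longrightarrow> ext_d (\<lambda>y. \<alpha> y + \<beta> y) x = ext_d \<alpha> x + ext_d \<beta> x"
  by (rule ext) (simp add: ext_d_def differentiable_form_def frechet_derivative_linear_ops sum.distrib algebra_simps)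

lemma ext_d_diff:
  "differentiable_form \<alpha> \<Longrightarrow> differentiable_form \<beta> \<Longrightarrow> ext_d (\<lambda>y. \<alpha> y - \<beta> y) x = ext_d \<alpha> x - ext_d \<beta> x"
  by (rule ext) (simp add: ext_d_def differentiable_form_def frechet_derivative_linear_ops sum_subtractf algebra_simps)

lemma ext_d_scale:
  "differentiable_form \<alpha> \<Longrightarrow> ext_d (\<lambda>y. scale_form c (\<alpha> y)) x = scale_form c (ext_d \<alpha> x)"
  by (rule ext) (simp add: ext_d_def scale_form_def differentiable_form_def frechet_derivative_linear_ops(3)[of "\<lambda>_. 0"]
      sum_distrib_left mult_ac)

lemma ext_d_minus: "differentiable_form \<alpha> \<Longrightarrow> ext_d (\<lambda>y. - \<alpha> y) x = - ext_d \<alpha> x"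
  unfolding minus_form_eq by (rule ext_d_scale)

lemma ext_d_const: "ext_d (\<lambda>y. \<alpha>) x = 0"
  by (rule ext) (simp add: ext_d_def frechet_derivative_const)

lemma ext_d_function_scale:
  assumes g: "g differentiable (at x)"
  shows "differentiable_form \<beta> \<Longrightarrow> ext_d (\<lambda>y. scale_form (g y) (\<beta> y)) x vs
    = cwedge (frechet_derivative g (at x)) (\<beta> x) vs + g x * ext_d \<beta> x vs"
proof (induction vs arbitrary: \<beta>)
  case Nil
  then show ?case by (simp add: ext_d_Nil cwedge_Nil)
next
  case (Cons v vs)
  have "(\<lambda>y. \<beta> y vs) differentiable (at x)"
    using Cons.prems by (simp add: differentiable_form_def)
  then have "frechet_derivative (\<lambda>y. scale_form (g y) (\<beta> y) vs) (at x) v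
      = frechet_derivative g (at x) v * \<beta> x vs + g x * frechet_derivative (\<lambda>y. \<beta> y vs) (at x) v"
    unfolding scale_form_apply by (rule frechet_derivative_scale[OF g])
  then show ?case
    using Cons.IH[OF differentiable_form_interior[OF Cons.prems, of v]]
    by (simp add: ext_d_rec cwedge_rec interior_linear(5) algebra_simps)
qed

lemma homogeneous_ext_d:
  assumes "\<And>y. homogeneous k (\<omega> y)" shows "homogeneous (Suc k) (ext_d \<omega> x)"
  using assms by (auto simp: homogeneous_def ext_d_def frechet_derivative_const intro!: sum.neutral)

lemma interior_ext_d_covector:
  assumes a: "\<And>v. (\<lambda>y. a y v) differentiable (at x)"
  shows "interior_product v (ext_d (\<lambda>y. covector (a y)) x)
    = covector (\<lambda>u. frechet_derivative (\<lambda>y. a y u) (at x) v - frechet_derivative (\<lambda>y. a y v) (at x) u)"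
    (is "_ = covector ?c")
proof
  fix vs
  show "interior_product v (ext_d (\<lambda>y. covector (a y)) x) vs = covector ?c vs"
  proof (cases "length vs = 1")
    case True
    then obtain u where "vs = [u]" by (auto simp: length_Suc_conv)
    then show ?thesis
      by (simp add: interior_apply ext_d_rec ext_d_Nil covector_def interior_product_def)
  next
    case False
    then show ?thesis
      using homogeneous_ext_d[of "Suc 0" "\<lambda>y. covector (a y)" x, OF homogeneous_covector]
      by (simp add: homogeneous_def interior_apply covector_def)
  qed
qed

lemma cwedge_diff_covector: "cwedge (\<lambda>v. a v - b v) \<beta> vs = cwedge a \<beta> vs - cwedge b \<beta> vs"
  by (induction vs arbitrary: \<beta>) (simp_all add: cwedge_Nil cwedge_rec algebra_simps)

text \<open>Contracting both sides with the first argument \<open>v\<close> and using the antiderivation rules leaves the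
  same identity for the contraction of \<open>\<beta>\<close> with \<open>v\<close>, plus a product with the function \<open>a y v\<close>.\<close>

lemma ext_d_cwedge_aux:
  assumes a: "\<And>v x. (\<lambda>y. a y v) differentiable (at x)"
  shows "differentiable_form \<beta> \<Longrightarrow> ext_d (\<lambda>y. cwedge (a y) (\<beta> y)) x vs
    = wedge (ext_d (\<lambda>y. covector (a y)) x) (\<beta> x) vs - cwedge (a x) (ext_d \<beta> x) vs"
proof (induction vs arbitrary: \<beta>)
  case Nil
  then show ?case by (simp add: ext_d_Nil cwedge_Nil wedge_Nil)
next
  case (Cons v vs)
  define da where "da = ext_d (\<lambda>y. covector (a y)) x"
  have h: "homogeneous (Suc (Suc 0)) da"
    unfolding da_def by (intro homogeneous_ext_d homogeneous_covector)
  note di = differentiable_form_interior[OF Cons.prems, of v]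
  have i\<beta>: "interior_product v (ext_d \<beta> x)
      = (\<lambda>us. frechet_derivative (\<lambda>y. \<beta> y us) (at x) v) - ext_d (\<lambda>y. interior_product v (\<beta> y)) x"
    by (rule ext) (simp add: interior_apply ext_d_rec)
  have "ext_d (\<lambda>y. interior_product v (cwedge (a y) (\<beta> y))) x vs
      = cwedge (frechet_derivative (\<lambda>y. a y v) (at x)) (\<beta> x) vs + a x v * ext_d \<beta> x vs
        - (wedge da (interior_product v (\<beta> x)) vs - cwedge (a x) (ext_d (\<lambda>y. interior_product v (\<beta> y)) x) vs)"
    unfolding interior_cwedge
    using ext_d_diff[OF differentiable_form_scale[OF a Cons.prems] differentiable_form_cwedge[OF a di]]
    by (simp add: ext_d_function_scale[OF a Cons.prems] Cons.IH[OF di] da_def)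
  moreover have "wedge da (\<beta> x) (v # vs)
      = cwedge (\<lambda>u. frechet_derivative (\<lambda>y. a y u) (at x) v) (\<beta> x) vs
        - cwedge (frechet_derivative (\<lambda>y. a y v) (at x)) (\<beta> x) vs
        + wedge da (interior_product v (\<beta> x)) vs"
    unfolding wedge_rec[OF h] unfolding da_def interior_ext_d_covector[OF a] cwedge_def[symmetric]
      cwedge_diff_covector by simp
  ultimately show ?case
    by (simp add: ext_d_rec frechet_derivative_cwedge[OF a Cons.prems] cwedge_rec i\<beta> cwedge_linear da_def)
qed

lemma ext_d_cwedge:
  assumes "\<And>v x. (\<lambda>y. a y v) differentiable (at x)" "differentiable_form \<beta>"
  shows "ext_d (\<lambda>y. cwedge (a y) (\<beta> y)) x
    = wedge (ext_d (\<lambda>y. covector (a y)) x) (\<beta> x) - cwedge (a x) (ext_d \<beta> x)"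
  by (rule ext) (simp add: ext_d_cwedge_aux[OF assms])

lemma lie_derivative_Nil: "lie_derivative X \<omega> x [] = frechet_derivative (\<lambda>y. \<omega> y []) (at x) (X x)"
  by (simp add: lie_derivative_def)

text \<open>The commutator of a Lie derivative with the interior product by a constant field is the interior
  product by their bracket.\<close>

lemma lie_derivative_rec:
  "lie_derivative X \<omega> x (v # vs) = lie_derivative X (\<lambda>y. interior_product v (\<omega> y)) x vs
     - \<omega> x (lie_bracket X (\<lambda>_. v) x # vs)"
  by (simp add: lie_derivative_def sum.lessThan_Suc_shift interior_product_def del: sum.lessThan_Suc)

lemma lie_derivative_add:
  "differentiable_form \<alpha> \<Longrightarrow> differentiable_form \<beta> \<Longrightarrow>
    lie_derivative X (\<lambda>y. \<alpha> y + \<beta> y) x = lie_derivative X \<alpha> x + lie_derivative X \<beta> x"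
  by (rule ext) (simp add: lie_derivative_def differentiable_form_def frechet_derivative_linear_ops sum.distrib)

lemma lie_derivative_diff:
  "differentiable_form \<alpha> \<Longrightarrow> differentiable_form \<beta> \<Longrightarrow>
    lie_derivative X (\<lambda>y. \<alpha> y - \<beta> y) x = lie_derivative X \<alpha> x - lie_derivative X \<beta> x"
  by (rule ext) (simp add: lie_derivative_def differentiable_form_def frechet_derivative_linear_ops sum_subtractf)

lemma lie_derivative_function_scale:
  assumes "g differentiable (at x)" "differentiable_form \<beta>"
  shows "lie_derivative X (\<lambda>y. scale_form (g y) (\<beta> y)) x vs
    = frechet_derivative g (at x) (X x) * \<beta> x vs + g x * lie_derivative X \<beta> x vs"
  using assms by (simp add: lie_derivative_def scale_form_def differentiable_form_def frechet_derivative_scale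
      sum_distrib_left algebra_simps)

lemma lie_derivative_minus:
  "differentiable_form \<alpha> \<Longrightarrow> lie_derivative X (\<lambda>y. - \<alpha> y) x = - lie_derivative X \<alpha> x"
  unfolding minus_form_eq
  by (rule ext) (simp add: lie_derivative_function_scale frechet_derivative_const scale_form_apply)

text \<open>The Lie derivative of a family of covectors.\<close>

definition lie_covector :: "(vec7 \<Rightarrow> vec7) \<Rightarrow> (vec7 \<Rightarrow> vec7 \<Rightarrow> real) \<Rightarrow> vec7 \<Rightarrow> vec7 \<Rightarrow> real" where
  "lie_covector X a x v = frechet_derivative (\<lambda>y. a y v) (at x) (X x) - a x (lie_bracket X (\<lambda>_. v) x)"

lemma lie_derivative_cwedge_aux:
  assumes a: "\<And>v x. (\<lambda>y. a y v) differentiable (at x)"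
  shows "differentiable_form \<beta> \<Longrightarrow> lie_derivative X (\<lambda>y. cwedge (a y) (\<beta> y)) x vs
    = cwedge (lie_covector X a x) (\<beta> x) vs + cwedge (a x) (lie_derivative X \<beta> x) vs"
proof (induction vs arbitrary: \<beta>)
  case Nil
  then show ?case by (simp add: lie_derivative_Nil cwedge_Nil frechet_derivative_const)
next
  case (Cons v vs)
  note di = differentiable_form_interior[OF Cons.prems, of v]
  let ?b = "lie_bracket X (\<lambda>_. v) x"
  have i\<beta>: "interior_product v (lie_derivative X \<beta> x)
      = lie_derivative X (\<lambda>y. interior_product v (\<beta> y)) x - interior_product ?b (\<beta> x)"
    by (rule ext) (simp add: interior_apply lie_derivative_rec)
  have "lie_derivative X (\<lambda>y. interior_product v (cwedge (a y) (\<beta> y))) x vs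
      = frechet_derivative (\<lambda>y. a y v) (at x) (X x) * \<beta> x vs + a x v * lie_derivative X \<beta> x vs
        - (cwedge (lie_covector X a x) (interior_product v (\<beta> x)) vs
           + cwedge (a x) (lie_derivative X (\<lambda>y. interior_product v (\<beta> y)) x) vs)"
    unfolding interior_cwedge
    using lie_derivative_diff[OF differentiable_form_scale[OF a Cons.prems] differentiable_form_cwedge[OF a di]]
    by (simp add: lie_derivative_function_scale[OF a Cons.prems] Cons.IH[OF di])
  then show ?case
    by (simp add: lie_derivative_rec cwedge_rec i\<beta> cwedge_linear) (simp add: lie_covector_def algebra_simps)
qed

lemma lie_derivative_cwedge:
  assumes "\<And>v x. (\<lambda>y. a y v) differentiable (at x)" "differentiable_form \<beta>"
  shows "lie_derivative X (\<lambda>y. cwedge (a y) (\<beta> y)) x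
    = cwedge (lie_covector X a x) (\<beta> x) + cwedge (a x) (lie_derivative X \<beta> x)"
  by (rule ext) (simp add: lie_derivative_cwedge_aux[OF assms])

lemma lie_derivative_const_unit: "lie_derivative X (\<lambda>y. unit_form) x = 0"
  by (rule ext) (auto simp: lie_derivative_def frechet_derivative_const)


section \<open>Left-invariant frames of the nilpotent group\<close>

text \<open>\<open>n12_d e k\<close> is the differential of the covector dual to \<open>e k\<close> prescribed by the structure equations.\<close>

definition n12_d :: "(7 \<Rightarrow> vec7) \<Rightarrow> 7 \<Rightarrow> form" where
  "n12_d e k =
    (if k = 4 then scale_form (sqrt 3 / 6) (basis_form e [1,2])
     else if k = 5 then scale_form (- (1/4)) (basis_form e [2,3]) + scale_form (sqrt 3 / 12) (basis_form e [1,3])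
     else if k = 6 then scale_form (- (sqrt 3 / 12)) (basis_form e [2,3]) - scale_form (1/4) (basis_form e [1,3])
     else if k = 7 then scale_form (- (sqrt 3 / 6)) (basis_form e [3,4]) + scale_form (sqrt 3 / 12) (basis_form e [2,5])
       + scale_form (1/4) (basis_form e [2,6]) + scale_form (sqrt 3 / 12) (basis_form e [1,6])
       - scale_form (1/4) (basis_form e [1,5])
     else 0)"

lemma n12_d_simps:
  "n12_d e 1 = 0" "n12_d e 2 = 0" "n12_d e 3 = 0"
  "n12_d e 4 = scale_form (sqrt 3 / 6) (basis_form e [1,2])"
  "n12_d e 5 = scale_form (- (1/4)) (basis_form e [2,3]) + scale_form (sqrt 3 / 12) (basis_form e [1,3])"
  "n12_d e 6 = scale_form (- (sqrt 3 / 12)) (basis_form e [2,3]) - scale_form (1/4) (basis_form e [1,3])"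
  "n12_d e 7 = scale_form (- (sqrt 3 / 6)) (basis_form e [3,4]) + scale_form (sqrt 3 / 12) (basis_form e [2,5])
       + scale_form (1/4) (basis_form e [2,6]) + scale_form (sqrt 3 / 12) (basis_form e [1,6])
       - scale_form (1/4) (basis_form e [1,5])"
  by (simp_all add: n12_d_def del: basis_form.simps)

lemma multilinear_zero: "multilinear 0"
  by (simp add: multilinear_def module_hom_zero)

lemma multilinear_n12_d: "is_basis e \<Longrightarrow> multilinear (n12_d e k)"
  by (simp add: n12_d_def multilinear_add multilinear_diff multilinear_scale multilinear_basis_form multilinear_zero
      del: basis_form.simps)

lemma homogeneous_n12_d: "homogeneous 2 (n12_d e k)"
  using basis_form_wrong_length[of _ "[_, _]" e]
  by (auto simp: n12_d_def homogeneous_def scale_form_def)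

lemma bilinear_eq_on_basis:
  fixes B C :: "vec7 \<Rightarrow> vec7 \<Rightarrow> real"
  assumes e: "is_basis e" and B: "\<And>v. linear (B v)" "\<And>w. linear (\<lambda>v. B v w)"
    and C: "\<And>v. linear (C v)" "\<And>w. linear (\<lambda>v. C v w)"
    and eq: "\<And>i j. B (e i) (e j) = C (e i) (e j)"
  shows "B v w = C v w"
proof -
  have "B (e i) w = C (e i) w" for i
    using linear_expansion[OF e B(1), of "e i" w] linear_expansion[OF e C(1), of "e i" w] eq by simp
  then show ?thesis
    using linear_expansion[OF e B(2), of v w] linear_expansion[OF e C(2), of v w] by simp
qed

lemma linear_frechet_derivative_family:
  fixes a :: "vec7 \<Rightarrow> vec7 \<Rightarrow> real"
  assumes "\<And>y. linear (a y)" "\<And>v. (\<lambda>y. a y v) differentiable (at x)"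
  shows "linear (\<lambda>v. frechet_derivative (\<lambda>y. a y v) (at x) w)"
proof (rule linearI)
  show "frechet_derivative (\<lambda>y. a y (u + v)) (at x) w
      = frechet_derivative (\<lambda>y. a y u) (at x) w + frechet_derivative (\<lambda>y. a y v) (at x) w" for u v
    using assms by (simp add: linear_add frechet_derivative_linear_ops(1))
  show "frechet_derivative (\<lambda>y. a y (c *\<^sub>R u)) (at x) w = c *\<^sub>R frechet_derivative (\<lambda>y. a y u) (at x) w" for c u
    using assms by (simp add: linear_cmul frechet_derivative_linear_ops(3)[of "\<lambda>_. 0"])
qed

text \<open>What is used of the Lie group: a global smooth frame whose brackets are those of \<open>n\<^sub>1\<^sub>2\<close> up to a
  common factor \<open>s\<close>. The factor accounts for homotheties, since \<open>c \<phi>\<^sub>1\<^sub>2\<close> is the form \<open>\<phi>\<^sub>1\<^sub>2\<close> of a rescaled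
  basis.\<close>

locale n12_frame =
  fixes F :: "vec7 \<Rightarrow> 7 \<Rightarrow> vec7" and s :: real
  assumes basis: "is_basis (F x)"
    and smooth_frame: "smooth (\<lambda>y. F y i)"
    and differentiable_coframe: "(\<lambda>y. dual_basis (F y) k v) differentiable (at x)"
    and structure_equations: "- dual_basis (F x) k (lie_bracket (\<lambda>y. F y i) (\<lambda>y. F y j) x) = s * n12_d (F x) k [F x i, F x j]"
    and s_nonzero: "s \<noteq> 0"
begin

abbreviation coframe :: "7 \<Rightarrow> vec7 \<Rightarrow> vec7 \<Rightarrow> real" where
  "coframe k x \<equiv> dual_basis (F x) k"

abbreviation \<phi> :: form_field where
  "\<phi> \<equiv> \<lambda>y. phi12 (F y)"

lemma has_derivative_frame: "((\<lambda>y. F y i) has_derivative frechet_derivative (\<lambda>y. F y i) (at x)) (at x)"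
  using smooth_frame Ck_has_derivative[of 0] unfolding smooth_def by blast

text \<open>The values of the coframe on the frame are constant.\<close>

lemma derivative_coframe_on_frame:
  "frechet_derivative (\<lambda>y. coframe k y (F x j)) (at x) u = - coframe k x (frechet_derivative (\<lambda>y. F y j) (at x) u)"
proof -
  have "((\<lambda>y. coframe k y (F y j)) has_derivative
    (\<lambda>u. frechet_derivative (\<lambda>y. coframe k y (F x j)) (at x) u
       + coframe k x (frechet_derivative (\<lambda>y. F y j) (at x) u))) (at x)"
    by (rule has_derivative_linear_family[OF linear_dual_basis[OF basis] differentiable_coframe has_derivative_frame])
  from fun_cong[OF frechet_derivative_at[OF this], of u] show ?thesis
    by (simp add: dual_basis_self[OF basis] frechet_derivative_const)
qed

text \<open>By \<open>derivative_coframe_on_frame\<close>, the differential of a coframe covector evaluates the bracket of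
  two frame fields, with the sign of the structure equations.\<close>

lemma ext_d_coframe: "ext_d (\<lambda>y. covector (coframe k y)) x = scale_form s (n12_d (F x) k)"
proof
  fix vs
  define B where "B u v = frechet_derivative (\<lambda>y. coframe k y v) (at x) u
    - frechet_derivative (\<lambda>y. coframe k y u) (at x) v" for u v
  have B: "ext_d (\<lambda>y. covector (coframe k y)) x [u, v] = B u v" for u v
    by (simp add: B_def ext_d_rec ext_d_Nil covector_def interior_product_def)
  have l1: "linear (frechet_derivative (\<lambda>y. coframe k y v) (at x))" for v
    using differentiable_coframe frechet_derivative_works has_derivative_linear by blast
  have l2: "linear (\<lambda>v. frechet_derivative (\<lambda>y. coframe k y v) (at x) u)" for u
    by (rule linear_frechet_derivative_family[OF linear_dual_basis[OF basis] differentiable_coframe])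
  have lB: "linear (B u)" "linear (\<lambda>u. B u v)" for u v
    unfolding B_def by (intro linear_compose_sub l1 l2)+
  have lC: "linear (\<lambda>v. s * n12_d (F x) k [u, v])" "linear (\<lambda>u. s * n12_d (F x) k [u, v])" for u v
    using multilinear_linear[OF multilinear_n12_d[OF basis], of x k "[u]" "[]"]
      multilinear_linear_hd[OF multilinear_n12_d[OF basis], of x k "[v]"]
    by (auto simp: linear_iff algebra_simps)
  have "B (F x i) (F x j) = s * n12_d (F x) k [F x i, F x j]" for i j
    unfolding structure_equations[symmetric] B_def derivative_coframe_on_frame lie_bracket_def
      linear_diff[OF linear_dual_basis[OF basis]] by simp
  then have eq: "B u v = s * n12_d (F x) k [u, v]" for u v
    by (rule bilinear_eq_on_basis[OF basis lB lC])
  show "ext_d (\<lambda>y. covector (coframe k y)) x vs = scale_form s (n12_d (F x) k) vs"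
  proof (cases "length vs = 2")
    case True
    then obtain u v where "vs = [u, v]"
      by (auto simp: length_Suc_conv numeral_2_eq_2)
    then show ?thesis by (simp add: B eq scale_form_apply)
  next
    case False
    then show ?thesis
      using homogeneous_ext_d[of "Suc 0" "\<lambda>y. covector (coframe k y)" x, OF homogeneous_covector]
        homogeneous_n12_d[of "F x" k]
      by (simp add: homogeneous_def scale_form_apply)
  qed
qed

lemma differentiable_basis_form: "differentiable_form (\<lambda>y. basis_form (F y) is)"
proof (induction "is")
  case Nil
  show ?case by (simp add: differentiable_form_const)
next
  case (Cons i "is")
  then show ?case
    unfolding basis_form_Cons by (intro differentiable_form_cwedge differentiable_coframe)
qed

lemma ext_d_basis_form:
  "ext_d (\<lambda>y. basis_form (F y) []) x = 0"
  "ext_d (\<lambda>y. basis_form (F y) (i # is)) x = scale_form s (wedge (n12_d (F x) i) (basis_form (F x) is))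
     - cwedge (coframe i x) (ext_d (\<lambda>y. basis_form (F y) is) x)"
  unfolding basis_form_Cons
    ext_d_cwedge[of "coframe i", OF differentiable_coframe differentiable_basis_form]
  by (simp_all add: ext_d_const ext_d_coframe wedge_scale_left)

lemmas ext_d_linear = ext_d_add ext_d_diff ext_d_minus ext_d_scale
  differentiable_form_add differentiable_form_diff differentiable_form_minus differentiable_basis_form

lemma ext_d_phi12: "ext_d \<phi> x = 0"
  unfolding phi12_eq
  apply (simp only: ext_d_linear ext_d_basis_form n12_d_simps wedge_linear wedge_basis_form append.simps cwedge_linear)
  apply (simp add: normal_form scale_form_0_1 del: basis_form.simps(1))
  apply (simp add: fun_eq_iff scale_form_apply algebra_simps)
  done

lemma ext_d_star_phi12:
  "ext_d (\<lambda>y. hodge (frame_metric (F y)) (frame_volume (F y)) (phi12 (F y))) x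
   = scale_form (- s / 2) (basis_form (F x) [1,2,3,4,7] + basis_form (F x) [1,2,4,5,6])"
  unfolding star_phi12[OF basis]
  apply (simp only: ext_d_linear ext_d_basis_form n12_d_simps wedge_linear wedge_basis_form append.simps cwedge_linear)
  apply (simp add: normal_form scale_form_0_1 del: basis_form.simps(1))
  apply (simp add: fun_eq_iff scale_form_apply algebra_simps)
  done

lemma ext_d_tau:
  "ext_d (\<lambda>y. scale_form (- s / 2) (basis_form (F y) [5,6] - basis_form (F y) [3,7])) x
   = scale_form (s\<^sup>2 / 4) (basis_form (F x) [2,3,6] - basis_form (F x) [1,3,5])"
  apply (simp only: ext_d_linear ext_d_basis_form n12_d_simps wedge_linear wedge_basis_form append.simps cwedge_linear)
  apply (simp add: normal_form scale_form_0_1 del: basis_form.simps(1))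
  apply (simp add: fun_eq_iff scale_form_apply algebra_simps power2_eq_square)
  done

lemma g2_star_frame: "g2_star \<phi> \<omega> x = hodge (frame_metric (F x)) (frame_volume (F x)) (\<omega> x)"
  by (simp add: g2_star_def g2_metric_phi12[OF basis] g2_vol_phi12[OF basis])

text \<open>The form is closed, so that the Laplacian is \<open>- d * d *\<close>, and this double differential is a
  combination of only two basis forms.\<close>

lemma laplacian_phi12:
  "hodge_laplacian \<phi> \<phi> x = scale_form (s\<^sup>2 / 4) (basis_form (F x) [1,3,5] - basis_form (F x) [2,3,6])"
proof -
  have "g2_star \<phi> (ext_d \<phi>) = (\<lambda>x. 0)"
    by (rule ext) (simp add: g2_star_frame ext_d_phi12 hodge_linear)
  then have 1: "g2_star \<phi> (ext_d (g2_star \<phi> (ext_d \<phi>))) x = 0"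
    by (simp add: g2_star_frame ext_d_const hodge_linear)
  have "ext_d (g2_star \<phi> \<phi>) = (\<lambda>x. scale_form (- s / 2) (basis_form (F x) [1,2,3,4,7] + basis_form (F x) [1,2,4,5,6]))"
    using ext_d_star_phi12 by (simp add: fun_eq_iff g2_star_frame[abs_def])
  then have "g2_star \<phi> (ext_d (g2_star \<phi> \<phi>))
      = (\<lambda>x. scale_form (- s / 2) (basis_form (F x) [5,6] - basis_form (F x) [3,7]))"
    by (intro ext) (simp add: g2_star_frame hodge_linear star_5_forms[OF basis])
  then have 2: "ext_d (g2_star \<phi> (ext_d (g2_star \<phi> \<phi>))) x
      = scale_form (s\<^sup>2 / 4) (basis_form (F x) [2,3,6] - basis_form (F x) [1,3,5])"
    by (simp only: ext_d_tau)
  show ?thesis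
    by (rule ext) (simp add: hodge_laplacian_def 1 2 scale_form_apply algebra_simps)
qed

end


section \<open>The soliton equation in a left-invariant frame\<close>

context n12_frame
begin

definition along :: "7 \<Rightarrow> (vec7 \<Rightarrow> real) \<Rightarrow> vec7 \<Rightarrow> real" where
  "along i g x = frechet_derivative g (at x) (F x i)"

lemma Ck_along:
  assumes "\<And>k. Ck k g"
  shows "Ck k (along i g)"
proof -
  have "along i g x = (\<Sum>b\<in>Basis. (F x i \<bullet> b) * frechet_derivative g (at x) b)" for x
  proof -
    have lin: "linear (frechet_derivative g (at x))"
      using Ck_has_derivative[OF assms] has_derivative_linear by blast
    have "frechet_derivative g (at x) (F x i) = frechet_derivative g (at x) (\<Sum>b\<in>Basis. (F x i \<bullet> b) *\<^sub>R b)"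
      by (simp add: euclidean_representation)
    then show ?thesis
      by (simp add: along_def linear_sum[OF lin] linear_cmul[OF lin])
  qed
  then have eq: "along i g = (\<lambda>x. \<Sum>b\<in>Basis. (F x i \<bullet> b) * frechet_derivative g (at x) b)"
    by (rule ext)
  have "Ck k (\<lambda>x. F x i)"
    using smooth_frame unfolding smooth_def by blast
  then have "Ck k (\<lambda>x. F x i \<bullet> b)" for b
    by (rule Ck_bounded_linear) (rule bounded_linear_inner_left)
  moreover have "Ck k (\<lambda>x. frechet_derivative g (at x) b)" for b
    by (rule Ck_directional[OF assms])
  ultimately show ?thesis
    unfolding eq by (intro Ck_sum Ck_mult)
qed

lemma along_commutator:
  assumes "\<And>k. Ck k g"
  shows "along i (along j g) x - along j (along i g) x
    = - s * (\<Sum>k\<in>UNIV. n12_d (F x) k [F x i, F x j] * along k g x)"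
proof -
  have lin: "linear (frechet_derivative g (at x))"
    using Ck_has_derivative[OF assms] has_derivative_linear by blast
  let ?b = "lie_bracket (\<lambda>y. F y i) (\<lambda>y. F y j) x"
  have c: "dual_basis (F x) k ?b = - s * n12_d (F x) k [F x i, F x j]" for k
    using structure_equations[of x k i j] by simp
  have "along i (along j g) x - along j (along i g) x = frechet_derivative g (at x) ?b"
    unfolding along_def lie_bracket_def
    by (rule commutator_of_fields[OF assms has_derivative_frame has_derivative_frame])
  also have "\<dots> = (\<Sum>k\<in>UNIV. dual_basis (F x) k ?b * along k g x)"
    using linear_expansion[OF basis lin, of ?b x] by (simp add: along_def)
  finally show ?thesis
    by (simp add: c sum_distrib_left mult.assoc)
qed

lemma gradient_eq:
  assumes "\<And>k. Ck k f"
  shows "gradient \<phi> f x = (\<Sum>i\<in>UNIV. along i f x *\<^sub>R F x i)"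
proof -
  have lin: "linear (frechet_derivative f (at x))"
    using Ck_has_derivative[OF assms] has_derivative_linear by blast
  have m: "g2_metric (\<phi> x) = frame_metric (F x)"
    by (rule g2_metric_phi12[OF basis])
  have l: "dual_basis (F x) j (\<Sum>i\<in>UNIV. along i f x *\<^sub>R F x i) = along j f x" for j
    by (simp add: linear_sum[OF linear_dual_basis[OF basis]] linear_cmul[OF linear_dual_basis[OF basis]]
        dual_basis_self[OF basis] if_distrib[of "\<lambda>x. _ * x"] cong: if_cong)
  show ?thesis
    unfolding gradient_def m
  proof (rule the_equality)
    show "\<forall>v. frame_metric (F x) (\<Sum>i\<in>UNIV. along i f x *\<^sub>R F x i) v = frechet_derivative f (at x) v"
    proof
      fix v
      show "frame_metric (F x) (\<Sum>i\<in>UNIV. along i f x *\<^sub>R F x i) v = frechet_derivative f (at x) v"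
        using linear_expansion[OF basis lin, of v x]
        unfolding frame_metric_def l by (simp add: along_def mult.commute)
    qed
  next
    fix X assume X: "\<forall>v. frame_metric (F x) X v = frechet_derivative f (at x) v"
    have "dual_basis (F x) i X = along i f x" for i
      using X[rule_format, of "F x i"] frame_metric_basis[OF basis, of x i X]
      by (simp add: along_def frame_metric_def mult.commute)
    then show "X = (\<Sum>i\<in>UNIV. along i f x *\<^sub>R F x i)"
      using basis_expansion[OF basis, of X x] by simp
  qed
qed

text \<open>The matrix of the Lie derivative of the coframe along the gradient of \<open>f\<close>. It is the matrix of
  second derivatives of \<open>f\<close> along the frame, corrected by the structure constants.\<close>

definition coframe_variation :: "(vec7 \<Rightarrow> real) \<Rightarrow> vec7 \<Rightarrow> 7 \<Rightarrow> 7 \<Rightarrow> real" where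
  "coframe_variation f x a i = lie_covector (gradient \<phi> f) (coframe i) x (F x a)"

lemma coframe_variation_eq:
  assumes f: "\<And>k. Ck k f"
  shows "coframe_variation f x a i
    = along a (along i f) x - s * (\<Sum>j\<in>UNIV. along j f x * n12_d (F x) i [F x a, F x j])"
proof -
  let ?D = "\<lambda>j. frechet_derivative (\<lambda>y. F y j) (at x)"
  let ?X' = "\<lambda>w. \<Sum>j\<in>UNIV. along j f x *\<^sub>R ?D j w + frechet_derivative (along j f) (at x) w *\<^sub>R F x j"
  note L = linear_sum[OF linear_dual_basis[OF basis]] linear_cmul[OF linear_dual_basis[OF basis]]
    linear_add[OF linear_dual_basis[OF basis]] linear_diff[OF linear_dual_basis[OF basis]]
  have X: "gradient \<phi> f = (\<lambda>x. \<Sum>i\<in>UNIV. along i f x *\<^sub>R F x i)"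
    by (rule ext) (rule gradient_eq[OF f])
  have dX: "(gradient \<phi> f has_derivative ?X') (at x)"
    unfolding X
    by (intro has_derivative_sum has_derivative_scaleR has_derivative_frame Ck_has_derivative[OF Ck_along[OF f]])
  have lb: "lie_bracket (gradient \<phi> f) (\<lambda>_. v) x = - ?X' v" for v
    unfolding lie_bracket_def frechet_derivative_at[OF dX, symmetric] frechet_derivative_const by simp
  have DX: "?D a (gradient \<phi> f x) = (\<Sum>j\<in>UNIV. along j f x *\<^sub>R ?D a (F x j))"
    unfolding X using has_derivative_linear[OF has_derivative_frame]
    by (simp add: linear_sum linear_cmul)
  have br: "coframe i x (?D j (F x a)) - coframe i x (?D a (F x j)) = - s * n12_d (F x) i [F x a, F x j]" for j
    using structure_equations[of x i a j] by (simp add: lie_bracket_def L)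
  have "coframe_variation f x a i = - coframe i x (?D a (gradient \<phi> f x)) + coframe i x (?X' (F x a))"
    by (simp add: coframe_variation_def lie_covector_def derivative_coframe_on_frame lb
        linear_neg[OF linear_dual_basis[OF basis]])
  also have "coframe i x (?X' (F x a)) = (\<Sum>j\<in>UNIV. along j f x * coframe i x (?D j (F x a))) + along a (along i f) x"
    by (simp add: L sum.distrib dual_basis_self[OF basis] if_distrib[of "\<lambda>x. _ * x"] along_def cong: if_cong)
  also have "coframe i x (?D a (gradient \<phi> f x)) = (\<Sum>j\<in>UNIV. along j f x * coframe i x (?D a (F x j)))"
    unfolding DX by (simp add: L)
  also have "- (\<Sum>j\<in>UNIV. along j f x * coframe i x (?D a (F x j)))
      + ((\<Sum>j\<in>UNIV. along j f x * coframe i x (?D j (F x a))) + along a (along i f) x)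
    = along a (along i f) x + (\<Sum>j\<in>UNIV. along j f x * (coframe i x (?D j (F x a)) - coframe i x (?D a (F x j))))"
    by (simp add: algebra_simps sum_subtractf)
  finally show ?thesis
    by (simp add: br sum_distrib_left sum_negf mult_ac)
qed

lemma lie_derivative_basis_form:
  "lie_derivative X (\<lambda>y. basis_form (F y) []) x = 0"
  "lie_derivative X (\<lambda>y. basis_form (F y) (i # is)) x
    = cwedge (lie_covector X (coframe i) x) (basis_form (F x) is)
      + cwedge (coframe i x) (lie_derivative X (\<lambda>y. basis_form (F y) is) x)"
  unfolding basis_form_Cons lie_derivative_cwedge[of "coframe i", OF differentiable_coframe differentiable_basis_form]
  by (simp_all add: lie_derivative_const_unit)

lemmas lie_derivative_linear = lie_derivative_add lie_derivative_diff lie_derivative_minus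
  differentiable_form_add differentiable_form_diff differentiable_form_minus differentiable_basis_form

context
  fixes f :: "vec7 \<Rightarrow> real" and lam :: real
  assumes f: "\<And>k. Ck k f"
    and soliton: "\<And>x vs. hodge_laplacian \<phi> \<phi> x vs = lam * \<phi> x vs + lie_derivative (gradient \<phi> f) \<phi> x vs"
begin

text \<open>On the seven triples of \<open>\<phi>\<^sub>1\<^sub>2\<close> the Lie derivative has as component the sum of the three diagonal
  entries of the matrix \<open>A\<close>, up to the sign of the triple. For an off-diagonal pair of indices, the
  symmetric part of \<open>A\<close> comes from four further triples, those that arise from a triple of \<open>\<phi>\<^sub>1\<^sub>2\<close> with
  exactly one of the two indices by exchanging it for the other: in the sum of these components with
  suitable signs all other entries cancel. The Laplacian has no such components.\<close>

lemma lie_components: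
  fixes x
  defines "A \<equiv> coframe_variation f x"
  shows "A 1 1 + A 2 2 + A 4 4 = - lam"
    and "A 1 1 + A 3 3 + A 5 5 = s\<^sup>2 / 4 - lam"
    and "A 1 1 + A 6 6 + A 7 7 = - lam"
    and "A 2 2 + A 3 3 + A 6 6 = s\<^sup>2 / 4 - lam"
    and "A 2 2 + A 5 5 + A 7 7 = - lam"
    and "A 3 3 + A 4 4 + A 7 7 = - lam"
    and "A 4 4 + A 5 5 + A 6 6 = - lam"
    and "A 3 7 + A 7 3 = 0"
    and "A 4 7 + A 7 4 = 0"
proof -
  define X where "X = gradient \<phi> f"
  have A: "lie_covector X (coframe i) x (F x a) = A a i" for a i
    by (simp add: A_def coframe_variation_def X_def)
  have "lie_derivative X \<phi> x [F x a, F x b, F x c]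
      = hodge_laplacian \<phi> \<phi> x [F x a, F x b, F x c] - lam * \<phi> x [F x a, F x b, F x c]" for a b c
    using soliton[of x "[F x a, F x b, F x c]"] by (simp add: X_def)
  note eq = this[unfolded laplacian_phi12, unfolded phi12_eq]
  note expand = lie_derivative_linear lie_derivative_basis_form
  note calc = basis_form_Cons cwedge_linear
    interior_linear interior_cwedge interior_frame[OF basis] dual_basis_self[OF basis]
    cwedge_rec cwedge_Nil scale_form_apply scale_form_0_1 interior_unit
    A
  show 1: "A 1 1 + A 2 2 + A 4 4 = - lam"
    using eq[of 1 2 4] by (simp only: expand) (simp add: calc)
  show 2: "A 1 1 + A 3 3 + A 5 5 = s\<^sup>2 / 4 - lam"
    using eq[of 1 3 5] by (simp only: expand) (simp add: calc)
  show 3: "A 1 1 + A 6 6 + A 7 7 = - lam"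
    using eq[of 1 6 7] by (simp only: expand) (simp add: calc)
  show 4: "A 2 2 + A 3 3 + A 6 6 = s\<^sup>2 / 4 - lam"
    using eq[of 2 3 6] by (simp only: expand) (simp add: calc)
  show 5: "A 2 2 + A 5 5 + A 7 7 = - lam"
    using eq[of 2 5 7] by (simp only: expand) (simp add: calc)
  show 6: "A 3 3 + A 4 4 + A 7 7 = - lam"
    using eq[of 3 4 7] by (simp only: expand) (simp add: calc)
  show 7: "A 4 4 + A 5 5 + A 6 6 = - lam"
    using eq[of 4 5 6] by (simp only: expand) (simp add: calc)
  show "A 3 7 + A 7 3 = 0"
    using eq[of 1 3 6] eq[of 2 6 7] eq[of 1 5 7] eq[of 2 3 5] by (simp only: expand) (simp add: calc)
  show "A 4 7 + A 7 4 = 0"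
    using eq[of 1 2 7] eq[of 1 4 6] eq[of 2 4 5] eq[of 5 6 7] by (simp only: expand) (simp add: calc)
qed

text \<open>Write \<open>u\<^sub>i\<close> for the derivative of \<open>f\<close> along the field \<open>F\<^sub>i\<close>. The diagonal components of the soliton
  equation form an invertible linear system, so each \<open>F\<^sub>i u\<^sub>i\<close> is a constant; the constants for \<open>i = 3\<close>
  and \<open>i = 7\<close> differ by \<open>s\<^sup>2 / 4\<close>. The field \<open>F\<^sub>7\<close> is central, and the off-diagonal components say that
  it rotates the pair \<open>(u\<^sub>3, u\<^sub>4)\<close>. Commuting \<open>F\<^sub>7\<close> with \<open>F\<^sub>3\<close> on \<open>u\<^sub>3\<close> and with \<open>F\<^sub>4\<close> on \<open>u\<^sub>4\<close> gives
  \<open>F\<^sub>3 u\<^sub>4 = 0\<close> and \<open>F\<^sub>4 u\<^sub>3 = 0\<close>. The difference of these is a nonzero multiple of \<open>u\<^sub>7\<close>, because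
  \<open>[F\<^sub>3, F\<^sub>4]\<close> is one of \<open>F\<^sub>7\<close>. So \<open>u\<^sub>7 = 0\<close>, then \<open>u\<^sub>4 = 0\<close> and \<open>u\<^sub>3 = 0\<close>, and both constants vanish.\<close>

lemma no_soliton: False
proof -
  note n = n12_d_simps scale_form_apply basis_form_Cons cwedge_rec cwedge_Nil interior_cwedge interior_unit
    interior_linear cwedge_linear dual_basis_self[OF basis] scale_form_0_1
  let ?u = "\<lambda>i. along i f"
  define r where "r = s * sqrt 3 / 6"
  have r: "r \<noteq> 0" using s_nonzero by (simp add: r_def)
  have u: "Ck k (?u i)" for k i by (rule Ck_along[OF f])
  have const: "along i (\<lambda>x. c) x = 0" for i c x
    by (simp add: along_def frechet_derivative_const)
  have scaled: "along i (\<lambda>x. c * ?u j x) x = c * along i (?u j) x" for i j c x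
    unfolding along_def[of i]
    using u[of 1 j] by (intro frechet_derivative_linear_ops(3)[of "\<lambda>_. 0"]) auto

  \<comment> \<open>The structure constants do not enter the diagonal entries of the matrix.\<close>
  have h33: "along 3 (?u 3) x = coframe_variation f x 3 3" for x
    by (simp add: coframe_variation_eq[OF f] n)
  have h44: "along 4 (?u 4) x = coframe_variation f x 4 4" for x
    by (simp add: coframe_variation_eq[OF f] n sum_7)
  have h77: "along 7 (?u 7) x = coframe_variation f x 7 7" for x
    by (simp add: coframe_variation_eq[OF f] n sum_7)
  have h37: "along 3 (?u 7) x + along 7 (?u 3) x = - r * ?u 4 x" for x
    using lie_components(8)[of x] by (simp add: coframe_variation_eq[OF f] n sum_7 r_def algebra_simps)
  have h47: "along 4 (?u 7) x + along 7 (?u 4) x = r * ?u 3 x" for x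
    using lie_components(9)[of x] by (simp add: coframe_variation_eq[OF f] n sum_7 r_def algebra_simps)

  have c34: "along 3 (along 4 g) x - along 4 (along 3 g) x = r * along 7 g x" if "\<And>k. Ck k g" for g x
    using along_commutator[OF that, of 3 4 x] by (simp add: n sum_7 r_def algebra_simps)
  have c37: "along 3 (along 7 g) x = along 7 (along 3 g) x" if "\<And>k. Ck k g" for g x
    using along_commutator[OF that, of 3 7 x] by (simp add: n sum_7 algebra_simps)
  have c47: "along 4 (along 7 g) x = along 7 (along 4 g) x" if "\<And>k. Ck k g" for g x
    using along_commutator[OF that, of 4 7 x] by (simp add: n sum_7 algebra_simps)

  have d3: "along 3 (?u 3) x = - lam / 3 + s\<^sup>2 / 6" for x
    using lie_components(1-7)[of x] unfolding h33 by linarith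
  have d4: "along 4 (?u 4) x = - lam / 3 - s\<^sup>2 / 12" for x
    using lie_components(1-7)[of x] unfolding h44 by linarith
  have d7: "along 7 (?u 7) x = - lam / 3 - s\<^sup>2 / 12" for x
    using lie_components(1-7)[of x] unfolding h77 by linarith

  \<comment> \<open>The field \<open>F\<^sub>7\<close> commutes with \<open>F\<^sub>3\<close>, so that both entries of \<open>h37\<close> contain the same derivative.\<close>
  have "along 7 (?u 3) = (\<lambda>x. - r / 2 * ?u 4 x)"
    by (rule ext) (use h37 c37[OF f] in \<open>simp add: field_simps\<close>)
  then have e34: "along 3 (?u 4) x = 0" for x
    using c37[OF u, of 3 x] scaled[of 3 "- r / 2" 4 x] r by (simp add: d3[abs_def] const)
  have "along 7 (?u 4) = (\<lambda>x. r / 2 * ?u 3 x)"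
    by (rule ext) (use h47 c47[OF f] in \<open>simp add: field_simps\<close>)
  then have e43: "along 4 (?u 3) x = 0" for x
    using c47[OF u, of 4 x] scaled[of 4 "r / 2" 3 x] r by (simp add: d4[abs_def] const)
  have "?u 7 x = 0" for x
    using c34[OF f, of x] e34[of x] e43[of x] r by simp
  then have u7: "?u 7 = (\<lambda>x. 0)" by (rule ext)
  have "?u 4 x = 0" for x
    using h37[of x] c37[OF f, of x] r by (simp add: u7 const)
  then have u4: "?u 4 = (\<lambda>x. 0)" by (rule ext)
  have "?u 3 x = 0" for x
    using h47[of x] r by (simp add: u7 u4 const)
  then have u3: "?u 3 = (\<lambda>x. 0)" by (rule ext)
  have "s\<^sup>2 = 0"
    using d3[of 0] d7[of 0] by (simp add: u3 u7 const)
  then show False using s_nonzero by simp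
qed

end

end


section \<open>Left-invariant fields on a Lie group\<close>

lemma phi12_map:
  assumes "\<And>i x. x \<in> set xs \<Longrightarrow> dual_basis e i (p x) = r * dual_basis e' i (q x)"
  shows "phi12 e (map p xs) = r ^ 3 * phi12 e' (map q xs)"
  using basis_form_map[of xs e p r e' q "[_, _, _]", OF assms]
  by (simp add: phi12_def algebra_simps eval_nat_numeral)

lemma n12_d_map:
  assumes "\<And>i x. x \<in> set xs \<Longrightarrow> dual_basis e i (p x) = r * dual_basis e' i (q x)"
  shows "n12_d e k (map p xs) = r ^ 2 * n12_d e' k (map q xs)"
  using basis_form_map[of xs e p r e' q "[_, _]", OF assms]
  by (simp add: n12_d_def scale_form_apply algebra_simps eval_nat_numeral)

locale euclidean_lie_group =
  fixes G :: "vec7 monoid"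
  assumes lie: "lie_group G"
begin

lemma group: "group G" and carrier: "carrier G = UNIV"
  using lie by (simp_all add: lie_group_def)

lemma assoc: "(x \<otimes>\<^bsub>G\<^esub> y) \<otimes>\<^bsub>G\<^esub> z = x \<otimes>\<^bsub>G\<^esub> (y \<otimes>\<^bsub>G\<^esub> z)"
  by (rule monoid.m_assoc[OF group.is_monoid[OF group]]) (simp_all add: carrier)

lemma one_left: "\<one>\<^bsub>G\<^esub> \<otimes>\<^bsub>G\<^esub> x = x" and one_right: "x \<otimes>\<^bsub>G\<^esub> \<one>\<^bsub>G\<^esub> = x"
  using monoid.l_one[OF group.is_monoid[OF group]] monoid.r_one[OF group.is_monoid[OF group]]
  by (simp_all add: carrier)

lemma inv_left: "inv\<^bsub>G\<^esub> x \<otimes>\<^bsub>G\<^esub> x = \<one>\<^bsub>G\<^esub>" and inv_right: "x \<otimes>\<^bsub>G\<^esub> inv\<^bsub>G\<^esub> x = \<one>\<^bsub>G\<^esub>"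
  using group.l_inv[OF group] group.r_inv[OF group] by (simp_all add: carrier)

lemma smooth_mult: "Ck k (\<lambda>(x, y). x \<otimes>\<^bsub>G\<^esub> y)"
  using lie unfolding lie_group_def smooth_def by blast

lemma smooth_translation: "Ck k (\<lambda>y. p \<otimes>\<^bsub>G\<^esub> y)"
proof -
  have "bounded_linear (\<lambda>y::vec7. (0::vec7, y))"
    by (intro bounded_linear_Pair bounded_linear_zero bounded_linear_ident)
  from Ck_affine[OF smooth_mult this, of k "(p, 0)"] show ?thesis by simp
qed

abbreviation translation_derivative :: "vec7 \<Rightarrow> vec7 \<Rightarrow> vec7 \<Rightarrow> vec7" where
  "translation_derivative p x \<equiv> frechet_derivative (\<lambda>y. p \<otimes>\<^bsub>G\<^esub> y) (at x)"

lemma has_derivative_translation: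
  "((\<lambda>y. p \<otimes>\<^bsub>G\<^esub> y) has_derivative translation_derivative p x) (at x)"
  by (rule Ck_has_derivative[OF smooth_translation])

lemma linear_translation: "linear (translation_derivative p x)"
  by (rule has_derivative_linear[OF has_derivative_translation])

lemma translation_derivative_eq:
  "translation_derivative p x v = frechet_derivative (\<lambda>(x, y). x \<otimes>\<^bsub>G\<^esub> y) (at (p, x)) (0, v)"
proof -
  have "((\<lambda>y. (p, y)) has_derivative (\<lambda>v. (0, v))) (at x)"
    by (auto intro!: derivative_eq_intros)
  from diff_chain_at[OF this Ck_has_derivative[OF smooth_mult]]
  have "((\<lambda>y. p \<otimes>\<^bsub>G\<^esub> y) has_derivative (\<lambda>v. frechet_derivative (\<lambda>(x, y). x \<otimes>\<^bsub>G\<^esub> y) (at (p, x)) (0, v))) (at x)"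
    by (simp add: o_def)
  from fun_cong[OF frechet_derivative_at[OF this], of v] show ?thesis by simp
qed

lemma translation_derivative_chain:
  "translation_derivative p (q \<otimes>\<^bsub>G\<^esub> x) (translation_derivative q x v) = translation_derivative (p \<otimes>\<^bsub>G\<^esub> q) x v"
proof -
  have "((\<lambda>y. (p \<otimes>\<^bsub>G\<^esub> q) \<otimes>\<^bsub>G\<^esub> y) has_derivative
      (\<lambda>v. translation_derivative p (q \<otimes>\<^bsub>G\<^esub> x) (translation_derivative q x v))) (at x)"
    using diff_chain_at[OF has_derivative_translation[of q x] has_derivative_translation[of p "q \<otimes>\<^bsub>G\<^esub> x"]]
    by (simp add: o_def assoc)
  from fun_cong[OF frechet_derivative_at[OF this], of v] show ?thesis .
qed

lemma translation_derivative_one: "translation_derivative \<one>\<^bsub>G\<^esub> x v = v"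
  using frechet_derivative_at[OF has_derivative_ident, of x] by (simp add: one_left)

lemma left_field_smooth: "smooth (left_field G v)"
  unfolding smooth_def
proof
  fix k
  have "bounded_linear (\<lambda>y::vec7. (y, 0::vec7))"
    by (intro bounded_linear_Pair bounded_linear_zero bounded_linear_ident)
  from Ck_affine[OF Ck_directional[OF smooth_mult, where v = "(0, v)"] this, where b = "(0, \<one>\<^bsub>G\<^esub>)"]
  show "Ck k (left_field G v)"
    by (simp add: left_field_def[abs_def] translation_derivative_eq)
qed

lemma has_derivative_left_field:
  "(left_field G v has_derivative frechet_derivative (left_field G v) (at x)) (at x)"
  using left_field_smooth Ck_has_derivative[of 0] unfolding smooth_def by blast

lemma left_field_translate: "left_field G v (p \<otimes>\<^bsub>G\<^esub> x) = translation_derivative p x (left_field G v x)"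
  using translation_derivative_chain[of p x "\<one>\<^bsub>G\<^esub>" v] by (simp add: left_field_def one_right)

lemma left_field_one: "left_field G v \<one>\<^bsub>G\<^esub> = v"
  by (simp add: left_field_def translation_derivative_one)

text \<open>A left translation carries left-invariant fields to themselves, hence also their brackets.\<close>

lemma lie_bracket_left_fields:
  "lie_bracket (left_field G v) (left_field G w) p = left_field G (lie_algebra_bracket G v w) p"
proof -
  have d: "frechet_derivative (\<lambda>y. translation_derivative p y (left_field G w y)) (at \<one>\<^bsub>G\<^esub>) u
      = frechet_derivative (left_field G w) (at p) (left_field G u p)" for u w
  proof -
    have "(left_field G w has_derivative frechet_derivative (left_field G w) (at p)) (at (p \<otimes>\<^bsub>G\<^esub> \<one>\<^bsub>G\<^esub>))"
      unfolding one_right by (rule has_derivative_left_field)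
    from fun_cong[OF frechet_derivative_at[OF diff_chain_at[OF has_derivative_translation this]], of u]
    show ?thesis
      by (simp add: o_def left_field_translate left_field_def[of G u])
  qed
  show ?thesis
    using commutator_of_fields[OF smooth_translation has_derivative_left_field has_derivative_left_field,
        of p w "\<one>\<^bsub>G\<^esub>" v]
    by (simp add: d left_field_one lie_bracket_def lie_algebra_bracket_def left_field_def[of G "_ - _"])
qed

text \<open>The functionals biorthogonal to a left-invariant frame translate back to the identity.\<close>

lemma left_frame:
  assumes e: "is_basis e"
  shows "is_basis (\<lambda>i. left_field G (e i) p)"
    and "dual_basis (\<lambda>i. left_field G (e i) p) k v = dual_basis e k (translation_derivative (inv\<^bsub>G\<^esub> p) p v)"
    and "dual_basis (\<lambda>i. left_field G (e i) p) k (left_field G w p) = dual_basis e k w"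
proof -
  let ?a = "\<lambda>k v. dual_basis e k (translation_derivative (inv\<^bsub>G\<^esub> p) p v)"
  have lin: "linear (?a k)" for k
    using linear_compose[OF linear_translation linear_dual_basis[OF e]] by (simp add: o_def)
  have a: "?a k (left_field G w p) = dual_basis e k w" for k w
    using translation_derivative_chain[of "inv\<^bsub>G\<^esub> p" p "\<one>\<^bsub>G\<^esub>" w]
    by (simp add: left_field_def one_right inv_left translation_derivative_one)
  have ae: "?a i (left_field G (e j) p) = (if i = j then 1 else 0)" for i j
    by (simp add: a dual_basis_self[OF e])
  show "is_basis (\<lambda>i. left_field G (e i) p)"
    using lin ae by (rule biorthogonal_imp_dual_basis(1))
  have "dual_basis (\<lambda>i. left_field G (e i) p) = ?a"
    using lin ae by (rule biorthogonal_imp_dual_basis(2))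
  then show b: "dual_basis (\<lambda>i. left_field G (e i) p) k v = ?a k v" for v
    by simp
  show "dual_basis (\<lambda>i. left_field G (e i) p) k (left_field G w p) = dual_basis e k w"
    by (simp only: b a)
qed

text \<open>By \<open>left_frame\<close>, the coframe at \<open>p\<close> is the translation of \<open>p\<close> to the identity followed by a fixed
  covector, which depends differentiably on \<open>p\<close> because the inverse does.\<close>

lemma differentiable_left_coframe:
  assumes e: "is_basis e"
  shows "(\<lambda>p. dual_basis (\<lambda>i. left_field G (e i) p) k v) differentiable (at x)"
proof -
  let ?m = "\<lambda>z. frechet_derivative (\<lambda>(x, y). x \<otimes>\<^bsub>G\<^esub> y) (at z) (0, v)"
  have "Ck (Suc 0) (\<lambda>x. inv\<^bsub>G\<^esub> x)"
    using lie unfolding lie_group_def smooth_def by blast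
  from Ck_has_derivative[OF this]
  have "((\<lambda>p. (inv\<^bsub>G\<^esub> p, p)) has_derivative (\<lambda>u. (frechet_derivative (\<lambda>x. inv\<^bsub>G\<^esub> x) (at x) u, u))) (at x)"
    by (intro has_derivative_Pair has_derivative_ident)
  from diff_chain_at[OF this Ck_has_derivative[OF Ck_directional[OF smooth_mult]]]
  have "((\<lambda>p. ?m (inv\<^bsub>G\<^esub> p, p)) has_derivative
    (\<lambda>u. frechet_derivative ?m (at (inv\<^bsub>G\<^esub> x, x)) (frechet_derivative (\<lambda>x. inv\<^bsub>G\<^esub> x) (at x) u, u))) (at x)"
    by (simp add: o_def)
  from bounded_linear.has_derivative[OF _ this, of "dual_basis e k"]
  show ?thesis
    unfolding left_frame(2)[OF e] translation_derivative_eq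
    using linear_dual_basis[OF e] by (auto simp: linear_conv_bounded_linear intro: differentiableI)
qed

lemma left_invariant_eq_phi12:
  assumes e: "is_basis e" and inv: "left_invariant G \<psi>" and one: "\<psi> \<one>\<^bsub>G\<^esub> = phi12 e"
  shows "\<psi> p = phi12 (\<lambda>i. left_field G (e i) p)"
proof
  fix ws
  define vs where "vs = map (translation_derivative (inv\<^bsub>G\<^esub> p) p) ws"
  have "left_field G (translation_derivative (inv\<^bsub>G\<^esub> p) p w) p = w" for w
    using translation_derivative_chain[of p "inv\<^bsub>G\<^esub> p" p w]
    by (simp add: left_field_def inv_left inv_right translation_derivative_one)
  then have ws: "map (\<lambda>v. left_field G v p) vs = ws"
    by (simp add: vs_def o_def)
  have "\<psi> (p \<otimes>\<^bsub>G\<^esub> \<one>\<^bsub>G\<^esub>) (map (translation_derivative p \<one>\<^bsub>G\<^esub>) vs) = \<psi> \<one>\<^bsub>G\<^esub> vs"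
    using inv unfolding left_invariant_def by blast
  then have "\<psi> p ws = phi12 e vs"
    using ws by (simp add: one_right one left_field_def)
  also have "\<dots> = phi12 (\<lambda>i. left_field G (e i) p) (map (\<lambda>v. left_field G v p) vs)"
    using phi12_map[of vs "\<lambda>i. left_field G (e i) p" "\<lambda>v. left_field G v p" 1 e "\<lambda>v. v"]
    by (simp add: left_frame(3)[OF e])
  finally show "\<psi> p ws = phi12 (\<lambda>i. left_field G (e i) p) ws"
    by (simp only: ws)
qed

lemma n12_frame_left_fields:
  assumes e: "is_basis e" and "s \<noteq> 0"
    and br: "\<And>k X Y. - dual_basis e k (lie_algebra_bracket G X Y) = s * n12_d e k [X, Y]"
  shows "n12_frame (\<lambda>p i. left_field G (e i) p) s"
proof
  fix x i j k v
  show "is_basis (\<lambda>i. left_field G (e i) x)"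
    by (rule left_frame(1)[OF e])
  show "smooth (\<lambda>y. left_field G (e i) y)"
    by (rule left_field_smooth)
  show "(\<lambda>y. dual_basis (\<lambda>i. left_field G (e i) y) k v) differentiable (at x)"
    by (rule differentiable_left_coframe[OF e])
  show "- dual_basis (\<lambda>i. left_field G (e i) x) k (lie_bracket (\<lambda>y. left_field G (e i) y) (\<lambda>y. left_field G (e j) y) x)
      = s * n12_d (\<lambda>i. left_field G (e i) x) k [left_field G (e i) x, left_field G (e j) x]"
    using n12_d_map[of "[e i, e j]" "\<lambda>i. left_field G (e i) x" "\<lambda>v. left_field G v x" 1 e "\<lambda>v. v" k] br[of k "e i" "e j"]
    by (simp add: lie_bracket_left_fields left_frame(3)[OF e])
  show "s \<noteq> 0" by fact
qed

end

lemma n12_basis_imp_n12_d: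
  "n12_basis br e \<Longrightarrow> - dual_basis e k (br X Y) = n12_d e k [X, Y]"
proof -
  assume "n12_basis br e"
  then have "\<forall>k. - dual_basis e k (br X Y) = n12_d e k [X, Y]"
    unfolding forall_7 n12_basis_def Let_def by (simp add: n12_d_def scale_form_apply del: basis_form.simps)
  then show ?thesis by blast
qed

text \<open>The isomorphism moves the basis, and the constant \<open>c\<close> is absorbed by rescaling the basis with its
  real cube root, which exists for either sign of \<open>c\<close>. The rescaling changes all structure constants by
  the same factor.\<close>

lemma homothetic_adapted_basis:
  assumes n12: "n12_basis br e" and hom: "homothetic br \<psi> br (phi12 e)"
  obtains e' s where "is_basis e'" "s \<noteq> 0" "\<psi> = phi12 e'"
    "\<And>k X Y. - dual_basis e' k (br X Y) = s * n12_d e' k [X, Y]"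
proof -
  have e: "is_basis e" using n12 by (simp add: n12_basis_def)
  obtain c h where c: "c \<noteq> 0" and lin: "linear h" and bij: "bij h"
    and h: "\<And>v w. h (br v w) = br (h v) (h w)"
    and \<psi>: "(\<lambda>vs. \<psi> (map (inv_into UNIV h) vs)) = (\<lambda>vs. c * phi12 e vs)"
    using hom by (auto simp: homothetic_def equivalent_def lie_algebra_iso_def)
  define r where "r = root 3 c"
  have r: "r \<noteq> 0" "r ^ 3 = c"
    using c by (simp_all add: r_def odd_real_root_pow)
  define e' where "e' i = inv_into UNIV h ((1 / r) *\<^sub>R e i)" for i
  have he': "h (e' i) = (1 / r) *\<^sub>R e i" for i
    using bij by (simp add: e'_def bij_is_surj surj_f_inv_f)
  have lin': "linear (\<lambda>v. r * dual_basis e i (h v))" for i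
    using linear_dual_basis[OF e, of i] lin by (auto simp: linear_iff algebra_simps)
  have bio: "r * dual_basis e i (h (e' j)) = (if i = j then 1 else 0)" for i j
    using r by (simp add: he' linear_cmul[OF linear_dual_basis[OF e]] dual_basis_self[OF e])
  have b': "is_basis e'"
    by (rule biorthogonal_imp_dual_basis(1)[OF lin' bio])
  have d': "dual_basis e' i v = r * dual_basis e i (h v)" for i v
    using biorthogonal_imp_dual_basis(2)[OF lin' bio] by simp
  have 1: "\<psi> = phi12 e'"
  proof
    fix ws
    have "\<psi> ws = c * phi12 e (map h ws)"
      using fun_cong[OF \<psi>, of "map h ws"] bij by (simp add: o_def bij_is_inj)
    also have "\<dots> = phi12 e' ws"
      using phi12_map[of ws e' "\<lambda>v. v" r e h] by (simp add: d' r)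
    finally show "\<psi> ws = phi12 e' ws" .
  qed
  have 2: "- dual_basis e' k (br X Y) = (1 / r) * n12_d e' k [X, Y]" for k X Y
    using n12_d_map[of "[X, Y]" e' "\<lambda>v. v" r e h k] n12_basis_imp_n12_d[OF n12, of k "h X" "h Y", symmetric] r
    by (simp add: d' h power2_eq_square)
  show thesis
    using that[OF b' _ 1 2] r by simp
qed

theorem proposition1p7:
  fixes N12 :: "(real^7) monoid" and e :: "7 \<Rightarrow> real^7" and \<psi> :: form_field
  assumes "lie_group N12"
    and "n12_basis (lie_algebra_bracket N12) e"
    and "left_invariant N12 \<psi>" and "g2_structure \<psi>"
    and "homothetic (lie_algebra_bracket N12) (\<psi> \<one>\<^bsub>N12\<^esub>) (lie_algebra_bracket N12) (phi12 e)"
  shows "\<not> (\<exists>(f :: real^7 \<Rightarrow> real) lam. smooth f \<and> \<not> f constant_on UNIV \<and>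
             gradient_laplacian_soliton \<psi> f lam)"
proof
  assume "\<exists>f lam. smooth f \<and> \<not> f constant_on UNIV \<and> gradient_laplacian_soliton \<psi> f lam"
  then obtain f lam where f: "\<And>k. Ck k f" and sol: "gradient_laplacian_soliton \<psi> f lam"
    unfolding smooth_def by blast
  interpret euclidean_lie_group N12
    by unfold_locales (rule assms(1))
  obtain e' s where e': "is_basis e'" and s: "s \<noteq> 0" and one: "\<psi> \<one>\<^bsub>N12\<^esub> = phi12 e'"
    and br: "\<And>k X Y. - dual_basis e' k (lie_algebra_bracket N12 X Y) = s * n12_d e' k [X, Y]"
    using homothetic_adapted_basis[OF assms(2,5)] by metis
  interpret n12_frame "\<lambda>p i. left_field N12 (e' i) p" s
    by (rule n12_frame_left_fields[OF e' s br])
  have "\<psi> = (\<lambda>p. phi12 (\<lambda>i. left_field N12 (e' i) p))"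
    by (rule ext) (rule left_invariant_eq_phi12[OF e' assms(3) one])
  with sol show False
    unfolding gradient_laplacian_soliton_def by (intro no_soliton[OF f, of lam]) auto
qed

end
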